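(* Let $\theta>0$. The sequences of random variables $(n^2d_n)_{n\ge1}$, $(n^2\widetilde d_n)_{n\ge1}$, $\left(\frac1{n^2d_n}\right)_{n\ge1}$ and $\left(\frac1{n^2\widetilde d_n}\right)_{n\ge1}$ are tight.
   Context: For each $n\ge1$, $\sigma_n$ is a random permutation in the symmetric group $\mathfrak S_n$ following the Ewens measure of parameter $\theta>0$: $\mathbb P(\sigma_n=\sigma)=\dfrac{\theta^{K(\sigma)}}{\theta(\theta+1)\cdots(\theta+n-1)}$, where $K(\sigma)$ is the total number of cycles of $\sigma$ (fixed points included). $(z_j)_{j\ge1}$ is a sequence of i.i.d. random variables uniformly distributed on the unit circle, independent of $(\sigma_n)_{n\ge1}$. The $n\times n$ random matrices $M_n$ and $\widetilde M_n$ have entries $(M_n)_{i,j}=\mathds{1}_{i=\sigma_n(j)}$ and $(\widetilde M_n)_{i,j}=z_i\mathds{1}_{i=\sigma_n(j)}$. Their eigenvalues lie on the unit circle. $d_n$ (resp. $\widetilde d_n$) is the smallest spacing between two consecutive distinct eigenangles of $M_n$ (resp. $\widetilde M_n$): the distinct eigenvalues cut the unit circle into arcs, and the spacings are the lengths of these arcs (the total being $2\pi$); if there is only one distinct eigenvalue the spacing is $2\pi$. A sequence $(Y_n)$ of real random variables is tight if for every $\varepsilon>0$ there is $\eta>0$ such that $\mathbb P(|Y_n|\le\eta)\ge1-\varepsilon$ for all $n$. *)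

theory Defs
  imports
    "HOL-Probability.Probability"
    "HOL-Combinatorics.Orbits"
    "Jordan_Normal_Form.Char_Poly"
begin

text \<open>
  Matrix rows and columns are indexed from 0, so the symmetric group of order \<open>n!\<close> is the set of
  permutations of \<open>{..<n}\<close>, and the phases \<open>z\<close> are indexed from 0 as well.
\<close>

abbreviation sym_space :: "nat \<Rightarrow> (nat \<Rightarrow> nat) measure" where
  "sym_space n \<equiv> count_space {\<pi>. \<pi> permutes {..<n}}"

text \<open>For a permutation, \<open>orbit \<pi> i\<close> contains \<open>i\<close>, so fixed points count as cycles.\<close>

definition num_cycles :: "nat \<Rightarrow> (nat \<Rightarrow> nat) \<Rightarrow> nat" where
  "num_cycles n \<pi> = card (orbit \<pi> ` {..<n})"

text \<open>\<open>pochhammer \<theta> n\<close> is the rising factorial \<open>\<theta> (\<theta> + 1) \<dots> (\<theta> + n - 1)\<close>.\<close>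

definition ewens :: "real \<Rightarrow> nat \<Rightarrow> (nat \<Rightarrow> nat) \<Rightarrow> real" where
  "ewens \<theta> n \<pi> = \<theta> ^ num_cycles n \<pi> / pochhammer \<theta> n"

abbreviation circle_space :: "complex measure" where
  "circle_space \<equiv> restrict_space borel (sphere 0 1)"

definition uniform_circle :: "complex measure" where
  "uniform_circle = distr (uniform_measure lborel {0..2 * pi}) circle_space cis"

definition perm_matrix :: "nat \<Rightarrow> (nat \<Rightarrow> nat) \<Rightarrow> complex Matrix.mat" where
  "perm_matrix n \<pi> = Matrix.mat n n (\<lambda>(i, j). of_bool (i = \<pi> j))"

definition phase_perm_matrix ::
    "nat \<Rightarrow> (nat \<Rightarrow> nat) \<Rightarrow> (nat \<Rightarrow> complex) \<Rightarrow> complex Matrix.mat" where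
  "phase_perm_matrix n \<pi> z = Matrix.mat n n (\<lambda>(i, j). z i * of_bool (i = \<pi> j))"

text \<open>
  All real arguments of the eigenvalues of modulus 1: a \<open>2\<pi>\<close>-periodic subset of the line.
  The gaps between neighbouring elements of this set are exactly the lengths of the arcs into which
  the distinct eigenvalues cut the circle. With a single eigenvalue the only gap is \<open>2\<pi>\<close>.
\<close>

definition eigenangles :: "complex Matrix.mat \<Rightarrow> real set" where
  "eigenangles A = {t. eigenvalue A (cis t)}"

definition spacings :: "complex Matrix.mat \<Rightarrow> real set" where
  "spacings A = {t - s | s t. s \<in> eigenangles A \<and> t \<in> eigenangles A \<and> s < t \<and>
                              {s<..<t} \<inter> eigenangles A = {}}"

definition min_spacing :: "complex Matrix.mat \<Rightarrow> real" where
  "min_spacing A = Min (spacings A)"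

text \<open>
  Tightness of the laws of \<open>(Y n)\<close> for \<open>n \<ge> 1\<close>; the shift removes the index 0, which the sequences
  considered here do not have. The lemma below gives the formulation in terms of \<open>\<bar>Y n\<bar>\<close>.
\<close>

definition tight_rvs :: "'a measure \<Rightarrow> (nat \<Rightarrow> 'a \<Rightarrow> real) \<Rightarrow> bool" where
  "tight_rvs M Y \<longleftrightarrow>
     (\<forall>n\<ge>1. Y n \<in> borel_measurable M) \<and> tight (\<lambda>n. distr M borel (Y (Suc n)))"

lemma (in prob_space) tight_rvs_iff:
  "tight_rvs M Y \<longleftrightarrow>
     (\<forall>n\<ge>1. random_variable borel (Y n)) \<and>
     (\<forall>\<epsilon>>0. \<exists>\<eta>>0. \<forall>n\<ge>1. prob {\<omega> \<in> space M. \<bar>Y n \<omega>\<bar> \<le> \<eta>} \<ge> 1 - \<epsilon>)"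
proof (cases "\<forall>n\<ge>1. random_variable borel (Y n)")
  case True
  then have meas [measurable]: "random_variable borel (Y (Suc n))" for n
    by simp
  have dist: "real_distribution (distr M borel (Y (Suc n)))" for n
    by (rule real_distribution_distr) simp
  have law: "measure (distr M borel (Y (Suc n))) {a<..b} =
      prob {\<omega> \<in> space M. a < Y (Suc n) \<omega> \<and> Y (Suc n) \<omega> \<le> b}" for n a b
    by (subst measure_distr) (auto intro!: arg_cong[where f = prob])
  have shift: "(\<forall>n\<ge>1. P n) \<longleftrightarrow> (\<forall>n. P (Suc n))" for P :: "nat \<Rightarrow> bool"
    by (metis One_nat_def Suc_le_D Suc_le_mono le0)
  have "(\<forall>\<epsilon>>0. \<exists>a b. a < b \<and>
          (\<forall>n. prob {\<omega> \<in> space M. a < Y (Suc n) \<omega> \<and> Y (Suc n) \<omega> \<le> b} > 1 - \<epsilon>)) \<longleftrightarrow>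
        (\<forall>\<epsilon>>0. \<exists>\<eta>>0. \<forall>n. prob {\<omega> \<in> space M. \<bar>Y (Suc n) \<omega>\<bar> \<le> \<eta>} \<ge> 1 - \<epsilon>)"
    (is "?L \<longleftrightarrow> ?R")
  proof
    assume L: ?L
    show ?R
    proof (intro allI impI)
      fix \<epsilon> :: real assume "\<epsilon> > 0"
      with L obtain a b where ab: "a < b"
        "\<And>n. prob {\<omega> \<in> space M. a < Y (Suc n) \<omega> \<and> Y (Suc n) \<omega> \<le> b} > 1 - \<epsilon>"
        by meson
      have "prob {\<omega> \<in> space M. a < Y (Suc n) \<omega> \<and> Y (Suc n) \<omega> \<le> b} \<le>
            prob {\<omega> \<in> space M. \<bar>Y (Suc n) \<omega>\<bar> \<le> \<bar>a\<bar> + \<bar>b\<bar>}" for n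
        by (rule finite_measure_mono) auto
      with ab show "\<exists>\<eta>>0. \<forall>n. prob {\<omega> \<in> space M. \<bar>Y (Suc n) \<omega>\<bar> \<le> \<eta>} \<ge> 1 - \<epsilon>"
        by (intro exI[of _ "\<bar>a\<bar> + \<bar>b\<bar>"]) (force intro: less_imp_le less_le_trans)
    qed
  next
    assume R: ?R
    show ?L
    proof (intro allI impI)
      fix \<epsilon> :: real assume e: "\<epsilon> > 0"
      then have "\<epsilon> / 2 > 0" by simp
      with R obtain \<eta> where eta: "\<eta> > 0"
        "\<And>n. prob {\<omega> \<in> space M. \<bar>Y (Suc n) \<omega>\<bar> \<le> \<eta>} \<ge> 1 - \<epsilon> / 2"
        by meson
      have le: "prob {\<omega> \<in> space M. \<bar>Y (Suc n) \<omega>\<bar> \<le> \<eta>} \<le>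
            prob {\<omega> \<in> space M. - \<eta> - 1 < Y (Suc n) \<omega> \<and> Y (Suc n) \<omega> \<le> \<eta>}" for n
        by (rule finite_measure_mono) auto
      have "prob {\<omega> \<in> space M. - \<eta> - 1 < Y (Suc n) \<omega> \<and> Y (Suc n) \<omega> \<le> \<eta>} > 1 - \<epsilon>" for n
        using le[of n] eta(2)[of n] e by linarith
      with eta show "\<exists>a b. a < b \<and>
          (\<forall>n. prob {\<omega> \<in> space M. a < Y (Suc n) \<omega> \<and> Y (Suc n) \<omega> \<le> b} > 1 - \<epsilon>)"
        by (intro exI[of _ "- \<eta> - 1"] exI[of _ \<eta>]) auto
    qed
  qed
  then show ?thesis
    unfolding tight_rvs_def tight_def law shift using meas dist by simp
qed (auto simp: tight_rvs_def)

end

theory Submission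
  imports Defs "HOL-Complex_Analysis.Cauchy_Integral_Theorem"
begin

text \<open>
  A cycle of length \<open>a\<close> contributes to the spectrum the \<open>a\<close>-th roots of the product of its phases (of 1
  for \<open>M\<^sub>n\<close>). The angles coming from two cycles of lengths \<open>a\<close> and \<open>b\<close> differ by all elements of a coset
  of \<open>2\<pi>\<int> / lcm a b\<close>, so the smallest spacing is at most \<open>2\<pi> / lcm a b\<close>, whatever the phases are.
  The upper bounds therefore follow once, with probability close to 1, some two cycles have
  \<open>lcm a b \<ge> c n\<^sup>2\<close>. To see this, explore the cycle of one element, of length \<open>a\<close>, and then a second cycle,
  of length \<open>b\<close>, on the remaining elements: the joint law of \<open>(a, b)\<close> is explicit, it puts little mass on
  \<open>a\<close> or \<open>a + b\<close> close to \<open>n\<close> and has density at most a constant times \<open>1 / n\<^sup>2\<close> elsewhere, while only a small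
  fraction of the pairs \<open>(a, b)\<close> has a small least common multiple.

  For the lower bounds, distinct angles of \<open>M\<^sub>n\<close> differ by at least \<open>2\<pi> / (a b) \<ge> 2\<pi> / n\<^sup>2\<close>. With random
  phases \<open>u\<close>, \<open>v\<close> of two cycles, a distance below \<open>\<delta>\<close> forces \<open>v\<^sup>a / u\<^sup>b\<close> into an arc of length \<open>a b \<delta>\<close>, which has
  probability at most \<open>a b \<delta>\<close>; the sum over all pairs of cycles is at most \<open>n\<^sup>2 \<delta>\<close>, for every permutation.
\<close>

section \<open>Splitting off a cycle of a permutation\<close>

lemma orbit_enum:
  fixes x :: 'a
  assumes "permutation p"
  defines "L \<equiv> card (orbit p x)"
  shows "0 < L" "(p ^^ L) x = x" "inj_on (\<lambda>k. (p ^^ k) x) {..<L}"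
    and "orbit p x = (\<lambda>k. (p ^^ k) x) ` {..<L}"
proof -
  have self: "x \<in> orbit p x"
    by (rule permutation_self_in_orbit[OF assms(1)])
  have img: "orbit p x = (\<lambda>k. (p ^^ k) x) ` {..<funpow_dist1 p x x}"
    using orbit_conv_funpow_dist1[OF self] by (simp add: atLeast0LessThan)
  have inj: "inj_on (\<lambda>k. (p ^^ k) x) {..<funpow_dist1 p x x}"
    using inj_on_funpow_dist1[OF self] by (simp add: atLeast0LessThan)
  have L: "L = funpow_dist1 p x x"
    unfolding L_def by (subst img, subst card_image[OF inj]) simp
  show "0 < L" "(p ^^ L) x = x" "inj_on (\<lambda>k. (p ^^ k) x) {..<L}"
    "orbit p x = (\<lambda>k. (p ^^ k) x) ` {..<L}"
    using img inj funpow_dist1_prop[OF self] by (simp_all only: L zero_less_Suc)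
qed

text \<open>A permutation that is one single cycle on \<open>T\<close> is determined by the list
  \<open>p x\<close>, \<open>p (p x)\<close>, ... of its first \<open>card T - 1\<close> iterates at
  \<open>x\<close>, and this list is an arrangement of \<open>T - {x}\<close>. Only injectivity of
  this encoding enters, hence an inequality.\<close>

lemma card_cyclic_permutations_le:
  assumes "finite T" "x \<in> T"
  shows "card {p. p permutes T \<and> orbit p x = T} \<le> fact (card T - 1)"
proof -
  let ?A = "{p. p permutes T \<and> orbit p x = T}"
  define \<phi> where "\<phi> p = map (\<lambda>k. (p ^^ Suc k) x) [0..<card T - 1]" for p :: "'a \<Rightarrow> 'a"
  have enum: "inj_on (\<lambda>k. (p ^^ k) x) {..<card T}" "T = (\<lambda>k. (p ^^ k) x) ` {..<card T}"
    "(p ^^ card T) x = x" if "p \<in> ?A" for p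
  proof -
    have "permutation p"
      using that assms permutation_permutes by blast
    from orbit_enum[OF this, of x] that
    show "inj_on (\<lambda>k. (p ^^ k) x) {..<card T}" "T = (\<lambda>k. (p ^^ k) x) ` {..<card T}"
      "(p ^^ card T) x = x" by auto
  qed
  have pos: "card T > 0"
    using assms by (auto simp: card_gt_0_iff)
  have "inj_on \<phi> ?A"
  proof (rule inj_onI)
    fix p q assume p: "p \<in> ?A" and q: "q \<in> ?A" and eq: "\<phi> p = \<phi> q"
    have pow: "(p ^^ k) x = (q ^^ k) x" if "k < card T" for k
    proof (cases k)
      case (Suc m)
      with that have "m < card T - 1" by simp
      then show ?thesis
        using arg_cong[OF eq, of "\<lambda>xs. xs ! m"] Suc by (simp add: \<phi>_def)
    qed simp
    \<comment> \<open>The exponent \<open>card T\<close>, at which both iterates are back at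
      \<open>x\<close>, is what determines the image of the last element of the cycle.\<close>
    have pow': "(p ^^ k) x = (q ^^ k) x" if "k \<le> card T" for k
      using that pow[of k] enum(3)[OF p] enum(3)[OF q] by (cases "k = card T") auto
    show "p = q"
    proof
      fix y
      show "p y = q y"
      proof (cases "y \<in> T")
        case True
        then obtain k where k: "k < card T" "y = (p ^^ k) x"
          using enum(2)[OF p] by auto
        then show ?thesis
          using pow'[of k] pow'[of "Suc k"] by simp
      next
        case False
        with p q show ?thesis by (auto simp: permutes_def)
      qed
    qed
  qed
  moreover have "\<phi> ` ?A \<subseteq> permutations_of_set (T - {x})"
  proof (rule image_subsetI)
    fix p assume A: "p \<in> ?A"
    have inj: "inj_on (\<lambda>k. (p ^^ Suc k) x) {0..<card T - 1}"
      by (rule inj_onI) (use inj_onD[OF enum(1)[OF A]] in \<open>fastforce\<close>)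
    then have "distinct (\<phi> p)"
      by (simp add: \<phi>_def distinct_map)
    moreover have "set (\<phi> p) = T - {x}"
    proof (rule card_subset_eq)
      show "finite (T - {x})" using assms by simp
      show "set (\<phi> p) \<subseteq> T - {x}"
      proof
        fix y assume "y \<in> set (\<phi> p)"
        then obtain k where k: "k < card T - 1" "y = (p ^^ Suc k) x"
          by (auto simp: \<phi>_def)
        then have "y \<in> T" using enum(2)[OF A] by (metis image_eqI lessThan_iff less_diff_conv Suc_eq_plus1)
        moreover have "y \<noteq> x"
        proof -
          have "Suc k < card T" using k(1) by linarith
          then show ?thesis
            using inj_onD[OF enum(1)[OF A], of "Suc k" 0] k(2) pos by auto
        qed
        ultimately show "y \<in> T - {x}" by simp
      qed
      show "card (set (\<phi> p)) = card (T - {x})"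
        using assms distinct_card[OF \<open>distinct (\<phi> p)\<close>] by (simp add: \<phi>_def)
    qed
    ultimately show "\<phi> p \<in> permutations_of_set (T - {x})"
      by (simp add: permutations_of_set_def)
  qed
  ultimately have "card ?A \<le> card (permutations_of_set (T - {x}))"
    using assms by (intro card_inj_on_le) auto
  also have "\<dots> = fact (card T - 1)"
    using assms by simp
  finally show ?thesis .
qed

lemma orbit_perm_restrict:
  assumes "p permutes S" "finite S" "i \<in> S - orbit p x"
  shows "orbit (perm_restrict p (S - orbit p x)) i = orbit p i"
proof -
  have cyc: "cyclic_on p (orbit p x)"
    using assms by (intro cyclic_on_orbit)
  have "p \<in> S - orbit p x \<rightarrow> S - orbit p x"
    using cyclic_on_f_in[OF assms(1) cyc] assms(1) by (auto simp: permutes_in_image)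
  from orbit_cong0[OF assms(3) this] show ?thesis
    by (metis perm_restrict_simps(1))
qed

text \<open>Removing the cycle of \<open>x\<close> leaves every other orbit unchanged. In the Ewens
  weight this costs exactly one factor \<theta>.\<close>

lemma card_orbits_restrict:
  assumes "p permutes S" "finite S" "x \<in> S"
  shows "card (orbit p ` S) =
    Suc (card (orbit (perm_restrict p (S - orbit p x)) ` (S - orbit p x)))"
proof -
  have cyc: "cyclic_on p (orbit p x)"
    using assms by (intro cyclic_on_orbit)
  have x: "x \<in> orbit p x"
    using assms permutation_permutes permutation_self_in_orbit by metis
  have sub: "orbit p x \<subseteq> S"
    using assms permutes_orbit_subset by metis
  have same: "orbit p i = orbit p x" if "i \<in> orbit p x" for i
    using orbit_cyclic_eq3[OF cyc that] .
  have "orbit p ` S = insert (orbit p x) (orbit p ` (S - orbit p x))"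
    using same sub assms(3) by auto
  moreover have "orbit p x \<notin> orbit p ` (S - orbit p x)"
  proof
    assume "orbit p x \<in> orbit p ` (S - orbit p x)"
    then obtain i where "i \<in> S - orbit p x" "orbit p x = orbit p i" by auto
    then show False
      using assms permutation_permutes permutation_self_in_orbit by (metis DiffD2)
  qed
  ultimately have "card (orbit p ` S) = Suc (card (orbit p ` (S - orbit p x)))"
    using assms by simp
  also have "orbit p ` (S - orbit p x) =
      orbit (perm_restrict p (S - orbit p x)) ` (S - orbit p x)"
    using orbit_perm_restrict[OF assms(1,2)] by (intro image_cong) auto
  finally show ?thesis .
qed

text \<open>The exploration step, stated so that it can be iterated: \<open>F\<close> tests the
  support \<open>T\<close> of the cycle of \<open>x\<close> together with the permutation left on
  \<open>S - T\<close>. A permutation is encoded by its restrictions to \<open>T\<close> and to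
  \<open>S - T\<close>; the first is a single cycle, so it takes at most
  \<open>fact (card T - 1)\<close> values, and it contributes one factor \<theta>. Since
  \<open>F\<close> is nonnegative, it is enough that the encoding is injective into the
  product.\<close>

lemma sum_permutes_split_cycle:
  fixes F :: "'a set \<Rightarrow> ('a \<Rightarrow> 'a) \<Rightarrow> real"
  assumes fin: "finite S" and x: "x \<in> S" and \<theta>: "0 \<le> \<theta>" and F: "\<And>T q. 0 \<le> F T q"
  shows "(\<Sum>p | p permutes S. \<theta> ^ card (orbit p ` S) *
            F (orbit p x) (perm_restrict p (S - orbit p x)))
       \<le> (\<Sum>T | x \<in> T \<and> T \<subseteq> S. \<theta> * fact (card T - 1) *
            (\<Sum>q | q permutes S - T. \<theta> ^ card (orbit q ` (S - T)) * F T q))"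
proof -
  let ?P = "{p. p permutes S}"
  let ?\<T> = "{T. x \<in> T \<and> T \<subseteq> S}"
  let ?w = "\<lambda>p. \<theta> ^ card (orbit p ` S) * F (orbit p x) (perm_restrict p (S - orbit p x))"
  have finP: "finite ?P" using fin by (rule finite_permutations)
  have fin\<T>: "finite ?\<T>" using fin by simp
  have x_in: "x \<in> orbit p x" if "p permutes S" for p
    using that fin permutation_permutes permutation_self_in_orbit by metis
  have maps: "(\<lambda>p. orbit p x) ` ?P \<subseteq> ?\<T>"
    using x_in permutes_orbit_subset x by fastforce
  have "sum ?w ?P = (\<Sum>T\<in>?\<T>. sum ?w {p \<in> ?P. orbit p x = T})"
    by (rule sum.group[OF finP fin\<T> maps, symmetric])
  also have "\<dots> \<le> (\<Sum>T\<in>?\<T>. \<theta> * fact (card T - 1) *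
            (\<Sum>q | q permutes S - T. \<theta> ^ card (orbit q ` (S - T)) * F T q))"
  proof (rule sum_mono)
    fix T assume T: "T \<in> ?\<T>"
    then have finT: "finite T" using fin finite_subset by auto
    let ?A = "{p \<in> ?P. orbit p x = T}"
    let ?C = "{p. p permutes T \<and> orbit p x = T}"
    let ?Q = "{q. q permutes S - T}"
    let ?v = "\<lambda>q. \<theta> ^ card (orbit q ` (S - T)) * F T q"
    \<comment> \<open>Outside the given set \<open>perm_restrict\<close> is the identity, so both
      components are permutations of their own parts.\<close>
    define \<psi> where "\<psi> p = (perm_restrict p T, perm_restrict p (S - T))" for p :: "'a \<Rightarrow> 'a"
    have cyc: "cyclic_on p T" if "p \<in> ?A" for p
      using that cyclic_on_orbit[of p S x] fin by auto
    have inj: "inj_on \<psi> ?A"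
    proof (rule inj_onI)
      fix p q assume p: "p \<in> ?A" and q: "q \<in> ?A" and eq: "\<psi> p = \<psi> q"
      have "p y = q y" for y
      proof (cases "y \<in> S")
        case True
        show ?thesis
        proof (cases "y \<in> T")
          case True
          then show ?thesis using eq unfolding \<psi>_def
            by (metis prod.inject perm_restrict_simps(1))
        next
          case False
          with \<open>y \<in> S\<close> have "y \<in> S - T" by simp
          then show ?thesis using eq unfolding \<psi>_def
            by (metis prod.inject perm_restrict_simps(1))
        qed
      next
        case False
        with p q show ?thesis by (auto simp: permutes_def)
      qed
      then show "p = q" by auto
    qed
    have img: "\<psi> ` ?A \<subseteq> ?C \<times> ?Q"
    proof (rule image_subsetI)
      fix p assume A: "p \<in> ?A"
      then have p: "p permutes S" and T': "T = orbit p x" by auto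
      show "\<psi> p \<in> ?C \<times> ?Q"
        unfolding \<psi>_def mem_Times_iff fst_conv snd_conv
      proof (intro conjI CollectI)
        show "perm_restrict p (S - T) permutes S - T"
          using perm_restrict_diff_cyclic[OF p cyc[OF A]] .
        have "p ` T \<subseteq> T" using cyc[OF A] cyclic_on_inI by fastforce
        moreover have "inj_on p T" using p by (meson permutes_inj inj_on_subset subset_UNIV)
        ultimately have "bij_betw p T T"
          using finT by (simp add: bij_betw_def endo_inj_surj)
        then have "bij_betw (perm_restrict p T) T T"
          by (subst bij_betw_cong[of _ _ p]) (auto simp: perm_restrict_simps)
        then show "perm_restrict p T permutes T"
          by (rule bij_imp_permutes) (simp add: perm_restrict_simps)
        have "x \<in> T" "p \<in> T \<rightarrow> T" using T \<open>p ` T \<subseteq> T\<close> by auto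
        from orbit_cong0[OF this, of "perm_restrict p T"]
        show "orbit (perm_restrict p T) x = T"
          using T' by (simp add: perm_restrict_simps)
      qed
    qed
    have finC: "finite ?C" and finQ: "finite ?Q"
      using finT fin finite_permutations[of T] finite_permutations[of "S - T"]
      by (auto intro: finite_subset)
    have nonneg: "0 \<le> \<theta> * ?v q" for q
      using \<theta> F by simp
    have "sum ?w ?A = (\<Sum>p\<in>?A. \<theta> * ?v (snd (\<psi> p)))"
    proof (rule sum.cong[OF refl])
      fix p assume p: "p \<in> ?A"
      then have "card (orbit p ` S) = Suc (card (orbit (perm_restrict p (S - T)) ` (S - T)))"
        using card_orbits_restrict[of p S x] fin x by auto
      with p show "?w p = \<theta> * ?v (snd (\<psi> p))"
        by (simp add: \<psi>_def)
    qed
    also have "\<dots> = (\<Sum>y\<in>\<psi> ` ?A. \<theta> * ?v (snd y))"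
      by (rule sum.reindex_cong[OF inj refl refl, symmetric])
    also have "\<dots> \<le> (\<Sum>y\<in>?C \<times> ?Q. \<theta> * ?v (snd y))"
      using finC finQ img nonneg by (intro sum_mono2) auto
    also have "\<dots> = (\<Sum>c\<in>?C. \<Sum>q\<in>?Q. \<theta> * ?v q)"
      by (simp only: sum.cartesian_product case_prod_unfold)
    also have "\<dots> = real (card ?C) * (\<Sum>q\<in>?Q. \<theta> * ?v q)"
      by simp
    also have "\<dots> \<le> fact (card T - 1) * (\<Sum>q\<in>?Q. \<theta> * ?v q)"
    proof (rule mult_right_mono)
      have "real (card ?C) \<le> real (fact (card T - 1))"
        using card_cyclic_permutations_le[OF finT, of x] T by (intro of_nat_mono) auto
      then show "real (card ?C) \<le> fact (card T - 1)" by simp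
      show "0 \<le> (\<Sum>q\<in>?Q. \<theta> * ?v q)" using nonneg by (intro sum_nonneg)
    qed
    also have "\<dots> = \<theta> * fact (card T - 1) * (\<Sum>q\<in>?Q. ?v q)"
      by (simp add: sum_distrib_left mult_ac)
    finally show "sum ?w ?A \<le> \<theta> * fact (card T - 1) * (\<Sum>q\<in>?Q. ?v q)" .
  qed
  finally show ?thesis .
qed

text \<open>Grouped by the number k of points outside \<open>T\<close>: there are (n-1 choose k)
  such sets, and (n-1 choose k) (n-1-k)! = (n-1)! / k!.\<close>

lemma sum_subsets_containing:
  fixes g :: "nat \<Rightarrow> real"
  assumes "finite S" "x \<in> S"
  shows "(\<Sum>T | x \<in> T \<and> T \<subseteq> S. fact (card T - 1) * g (card S - card T))
       = (\<Sum>k<card S. fact (card S - 1) / fact k * g k)"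
proof -
  let ?n = "card S"
  let ?\<T> = "{T. x \<in> T \<and> T \<subseteq> S}"
  have n: "?n > 0" using assms by (auto simp: card_gt_0_iff)
  \<comment> \<open>Complementation turns these \<open>T\<close> into the k-element subsets of
    \<open>S - {x}\<close>.\<close>
  have card_k: "card {T \<in> ?\<T>. ?n - card T = k} = (?n - 1) choose k" if k: "k < ?n" for k
  proof -
    have "bij_betw (\<lambda>U. S - U) {U. U \<subseteq> S - {x} \<and> card U = k} {T \<in> ?\<T>. ?n - card T = k}"
    proof (rule bij_betwI[where g = "\<lambda>T. S - T"])
      show "(\<lambda>U. S - U) \<in> {U. U \<subseteq> S - {x} \<and> card U = k} \<rightarrow> {T \<in> ?\<T>. ?n - card T = k}"
      proof safe
        fix U assume U: "U \<subseteq> S - {x}" "k = card U"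
        have "finite U" using U assms finite_subset by blast
        then have "card (S - U) = ?n - card U" using U by (intro card_Diff_subset) auto
        moreover have "card U \<le> ?n" using U assms by (intro card_mono) auto
        ultimately show "?n - card (S - U) = card U" by simp
      qed (use assms in auto)
      show "(\<lambda>T. S - T) \<in> {T \<in> ?\<T>. ?n - card T = k} \<rightarrow> {U. U \<subseteq> S - {x} \<and> card U = k}"
        using assms by (auto simp: card_Diff_subset finite_subset)
    qed auto
    then have "card {T \<in> ?\<T>. ?n - card T = k} = card {U. U \<subseteq> S - {x} \<and> card U = k}"
      by (rule bij_betw_same_card[symmetric])
    also have "\<dots> = (?n - 1) choose k"
      using assms by (subst n_subsets) auto
    finally show ?thesis .
  qed
  have maps: "(\<lambda>T. ?n - card T) ` ?\<T> \<subseteq> {..<?n}"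
  proof (rule image_subsetI)
    fix T assume "T \<in> ?\<T>"
    then have "card T > 0" using assms finite_subset by (auto simp: card_gt_0_iff)
    then show "?n - card T \<in> {..<?n}" using n by auto
  qed
  have "(\<Sum>T\<in>?\<T>. fact (card T - 1) * g (?n - card T))
      = (\<Sum>k<?n. \<Sum>T\<in>{T \<in> ?\<T>. ?n - card T = k}. fact (card T - 1) * g (?n - card T))"
    using assms by (intro sum.group[symmetric] maps) auto
  also have "\<dots> = (\<Sum>k<?n. \<Sum>T\<in>{T \<in> ?\<T>. ?n - card T = k}. fact (?n - 1 - k) * g k)"
  proof (intro sum.cong refl)
    fix k T assume k: "k \<in> {..<?n}" and T: "T \<in> {T \<in> ?\<T>. ?n - card T = k}"
    then have "card T \<le> ?n" using assms by (auto intro: card_mono)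
    then have "card T - 1 = ?n - 1 - k" using T by auto
    with T show "fact (card T - 1) * g (?n - card T) = fact (?n - 1 - k) * g k" by simp
  qed
  also have "\<dots> = (\<Sum>k<?n. fact (?n - 1) / fact k * g k)"
  proof (intro sum.cong refl)
    fix k assume "k \<in> {..<?n}"
    then have k: "k \<le> ?n - 1" "k < ?n" using n by auto
    have "real ((?n - 1) choose k) * fact (?n - 1 - k) = fact (?n - 1) / fact k"
      using binomial_fact[OF k(1), where 'a = real] by (simp add: field_simps)
    then show "(\<Sum>T\<in>{T \<in> ?\<T>. ?n - card T = k}. fact (?n - 1 - k) * g k) =
        fact (?n - 1) / fact k * g k"
      using card_k[OF k(2)] by (simp add: mult_ac flip: mult.assoc)
  qed
  finally show ?thesis .
qed

text \<open>The coefficient of x^k in (1 - x)^(-\<theta>). It arises because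
  \<open>pochhammer \<theta> k\<close> bounds the total weight of the k points left over, while
  \<open>sum_subsets_containing\<close> supplies 1 / k!. Relative to n
  \<open>rise \<theta> n\<close>, the quantity \<theta> \<open>rise \<theta> k\<close> bounds the
  probability that the cycle of a given point leaves k of n points.\<close>

definition rise :: "real \<Rightarrow> nat \<Rightarrow> real" where
  "rise \<theta> k = pochhammer \<theta> k / fact k"

lemma rise_pos: "0 < \<theta> \<Longrightarrow> 0 < rise \<theta> k"
  by (simp add: rise_def pochhammer_pos)

lemma rise_Suc: "real (Suc k) * rise \<theta> (Suc k) = (\<theta> + k) * rise \<theta> k"
  by (simp add: rise_def pochhammer_Suc del: of_nat_Suc)

text \<open>Adding the term k = n to both sides turns n \<open>rise \<theta> n\<close> into
  (\<theta> + n) \<open>rise \<theta> n\<close>, which is the next right-hand side by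
  \<open>rise_Suc\<close>.\<close>

lemma sum_rise: "\<theta> * (\<Sum>k<n. rise \<theta> k) = n * rise \<theta> n"
proof (induction n)
  case (Suc n)
  then show ?case
    unfolding rise_Suc by (simp add: distrib_left distrib_right)
qed simp

lemma pochhammer_eq_rise: "n > 0 \<Longrightarrow> pochhammer \<theta> n = fact (n - 1) * (n * rise \<theta> n)"
  by (cases n) (simp_all add: rise_def del: of_nat_Suc)

text \<open>Induction on \<open>S\<close>: splitting off the cycle of one point gives a recursion
  over the number of remaining points, and \<open>sum_rise\<close> shows that the rising factorial
  solves it.\<close>

lemma ewens_total_le:
  fixes \<theta> :: real
  assumes "finite S" "0 \<le> \<theta>"
  shows "(\<Sum>p | p permutes S. \<theta> ^ card (orbit p ` S)) \<le> pochhammer \<theta> (card S)"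
  using assms(1)
proof (induction S rule: finite_psubset_induct)
  case (psubset S)
  show ?case
  proof (cases "S = {}")
    case False
    then obtain x where x: "x \<in> S" by auto
    let ?n = "card S"
    have n: "?n > 0" using psubset x by (auto simp: card_gt_0_iff)
    have "(\<Sum>p | p permutes S. \<theta> ^ card (orbit p ` S)) \<le>
      (\<Sum>T | x \<in> T \<and> T \<subseteq> S. \<theta> * fact (card T - 1) *
            (\<Sum>q | q permutes S - T. \<theta> ^ card (orbit q ` (S - T))))"
      using sum_permutes_split_cycle[OF psubset.hyps(1) x assms(2), of "\<lambda>_ _. 1"] by simp
    also have "\<dots> \<le> (\<Sum>T | x \<in> T \<and> T \<subseteq> S. \<theta> * fact (card T - 1) * pochhammer \<theta> (card S - card T))"
    proof (intro sum_mono mult_left_mono)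
      fix T assume T: "T \<in> {T. x \<in> T \<and> T \<subseteq> S}"
      then have "S - T \<subset> S" by auto
      from psubset.IH[OF this] T psubset.hyps(1)
      show "(\<Sum>q | q permutes S - T. \<theta> ^ card (orbit q ` (S - T))) \<le> pochhammer \<theta> (card S - card T)"
        by (auto simp: card_Diff_subset finite_subset)
    qed (use assms in auto)
    also have "\<dots> = \<theta> * (\<Sum>T | x \<in> T \<and> T \<subseteq> S. fact (card T - 1) * pochhammer \<theta> (card S - card T))"
      by (simp add: sum_distrib_left mult_ac)
    also have "\<dots> = \<theta> * (\<Sum>k<?n. fact (?n - 1) / fact k * pochhammer \<theta> k)"
      by (subst sum_subsets_containing[OF psubset.hyps(1) x, of "pochhammer \<theta>"]) (rule refl)
    also have "\<dots> = fact (?n - 1) * (\<theta> * (\<Sum>k<?n. rise \<theta> k))"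
      by (simp add: sum_distrib_left mult_ac rise_def)
    also have "\<dots> = pochhammer \<theta> ?n"
      unfolding sum_rise using pochhammer_eq_rise[OF n] by simp
    finally show ?thesis .
  qed simp
qed

section \<open>Least common multiples of cycle lengths under the Ewens measure\<close>

lemma rise_mono:
  assumes "0 < \<theta>" "k \<le> n"
  shows "(\<theta> + k) * rise \<theta> k \<le> (\<theta> + n) * rise \<theta> n"
  using assms(2)
proof (induction n rule: dec_induct)
  case (step m)
  have "(\<theta> + m) * rise \<theta> m = real (Suc m) * rise \<theta> (Suc m)"
    by (rule rise_Suc[symmetric])
  \<comment> \<open>For \<theta> < 1 \<open>rise\<close> itself decreases; the factor \<theta> + k
    is what makes the sequence increasing for every \<theta> > 0.\<close>
  also have "\<dots> \<le> (\<theta> + real (Suc m)) * rise \<theta> (Suc m)"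
    using assms rise_pos[of \<theta> "Suc m"] by (intro mult_right_mono) auto
  finally have "(\<theta> + m) * rise \<theta> m \<le> (\<theta> + real (Suc m)) * rise \<theta> (Suc m)" .
  with step show ?case by linarith
qed simp

text \<open>By Gauss's product for the Gamma function, k \<open>rise \<theta> k\<close> is of exact
  order k^\<theta>. Comparing two indices therefore costs only a constant and the ratio to the power
  \<theta>.\<close>

lemma rise_growth:
  assumes "0 < \<theta>"
  obtains C where "C > 0"
    and "\<And>k n. 0 < k \<Longrightarrow> k \<le> n \<Longrightarrow> k * rise \<theta> k \<le> C * (real k / n) powr \<theta> * (n * rise \<theta> n)"
proof -
  \<comment> \<open>The reciprocal of \<open>Gamma_series \<theta> n\<close> for n > 0. Its limit is
    finite and nonzero, so both \<open>g\<close> and its inverse are bounded.\<close>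
  define g where "g n = (\<theta> + n) * rise \<theta> n / n powr \<theta>" for n :: nat
  have gpos: "g n > 0" if "n > 0" for n
    using assms rise_pos[of \<theta> n] that by (auto simp: g_def)
  have series: "Gamma_series \<theta> n = inverse (g n)" if "n > 0" for n
    using that assms
    by (simp add: Gamma_series_def g_def rise_def pochhammer_Suc powr_def field_simps)
  have lim: "(\<lambda>n. Gamma_series \<theta> n) \<longlonglongrightarrow> Gamma \<theta>"
    by (rule Gamma_series_LIMSEQ)
  have lim1: "(\<lambda>n. inverse (g n)) \<longlonglongrightarrow> Gamma \<theta>"
    by (rule Lim_transform_eventually[OF lim])
       (use series in \<open>auto intro!: eventually_mono[OF eventually_gt_at_top[of 0]]\<close>)
  have "Gamma \<theta> \<noteq> 0" using Gamma_real_pos[OF assms] by simp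
  from tendsto_inverse[OF lim1 this] have lim2: "g \<longlonglongrightarrow> inverse (Gamma \<theta>)"
    by simp
  obtain A where A: "A > 0" "\<And>n. norm (inverse (g n)) \<le> A"
    using convergent_imp_Bseq[OF convergentI[OF lim1]] by (auto elim: BseqE)
  obtain B where B: "B > 0" "\<And>n. norm (g n) \<le> B"
    using convergent_imp_Bseq[OF convergentI[OF lim2]] by (auto elim: BseqE)
  \<comment> \<open>\<open>B\<close> bounds \<open>g\<close> at k, \<open>A\<close> bounds the
    inverse of \<open>g\<close> at n, and 1 + \<theta> pays for replacing \<theta> + n by a multiple
    of n.\<close>
  show thesis
  proof (rule that[of "A * B * (1 + \<theta>)"])
    show "A * B * (1 + \<theta>) > 0" using A B assms by simp
    fix k n :: nat assume k: "0 < k" "k \<le> n"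
    then have n: "0 < n" by simp
    have "k * rise \<theta> k \<le> (\<theta> + k) * rise \<theta> k"
      using assms rise_pos[of \<theta> k] by (intro mult_right_mono) auto
    also have "\<dots> = g k * k powr \<theta>" using k by (simp add: g_def)
    also have "\<dots> \<le> B * k powr \<theta>"
      using B(2)[of k] by (intro mult_right_mono) auto
    finally have 1: "k * rise \<theta> k \<le> B * k powr \<theta>" .
    have "inverse (g n) \<le> A" using A(2)[of n] gpos[OF n] by simp
    then have "1 \<le> A * g n" using gpos[OF n] by (simp add: field_simps)
    then have "n powr \<theta> \<le> A * g n * n powr \<theta>"
      using mult_right_mono[of 1 "A * g n" "n powr \<theta>"] by simp
    also have "\<dots> = A * ((\<theta> + n) * rise \<theta> n)" using n by (simp add: g_def)
    also have "\<dots> \<le> A * (((1 + \<theta>) * n) * rise \<theta> n)"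
      using A assms rise_pos[of \<theta> n] n
      by (intro mult_left_mono mult_right_mono) (auto simp: field_simps)
    finally have 2: "n powr \<theta> \<le> A * (1 + \<theta>) * (n * rise \<theta> n)" by (simp add: mult_ac)
    have "B * k powr \<theta> = B * (real k / n) powr \<theta> * n powr \<theta>"
      using k n by (simp add: powr_divide)
    also have "\<dots> \<le> B * (real k / n) powr \<theta> * (A * (1 + \<theta>) * (n * rise \<theta> n))"
      using B 2 by (intro mult_left_mono) auto
    finally show "k * rise \<theta> k \<le> A * B * (1 + \<theta>) * (real k / n) powr \<theta> * (n * rise \<theta> n)"
      using 1 by (simp add: mult_ac)
  qed
qed

text \<open>By \<open>sum_rise\<close> the partial sum up to K is K \<open>rise \<theta> K\<close> /
  \<theta>, and \<open>rise_growth\<close> bounds it by a multiple of (K/n)^\<theta>, which is small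
  with \<delta>. In probabilistic terms, a cycle rarely swallows almost everything.\<close>

lemma sum_rise_initial_small:
  assumes "0 < \<theta>" "0 < \<eta>"
  obtains \<delta> :: real where "0 < \<delta>" "\<delta> \<le> 1"
    and "\<And>n :: nat. 1 \<le> \<delta> * n \<Longrightarrow> (\<Sum>k<nat \<lceil>\<delta> * n\<rceil>. rise \<theta> k) \<le> \<eta> * (n * rise \<theta> n)"
proof -
  obtain C where C: "C > 0"
    "\<And>k n. 0 < k \<Longrightarrow> k \<le> n \<Longrightarrow> k * rise \<theta> k \<le> C * (real k / n) powr \<theta> * (n * rise \<theta> n)"
    using rise_growth[OF assms(1)] by blast
  \<comment> \<open>\<open>r\<close> solves C r^\<theta> = \<eta> \<theta>. Half of it is taken for
    \<delta> because rounding up gives K \<le> \<delta> n + 1 \<le> 2 \<delta> n, by the hypothesis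
    1 \<le> \<delta> n.\<close>
  define r where "r = (\<eta> * \<theta> / C) powr (1 / \<theta>)"
  define \<delta> where "\<delta> = min 1 (r / 2)"
  have r: "r > 0" "r powr \<theta> = \<eta> * \<theta> / C"
    using assms C by (auto simp: r_def powr_powr)
  show thesis
  proof (rule that[of \<delta>])
    show "0 < \<delta>" and \<delta>1: "\<delta> \<le> 1" using r by (auto simp: \<delta>_def)
    fix n :: nat assume n: "1 \<le> \<delta> * real n"
    define K where "K = nat \<lceil>\<delta> * n\<rceil>"
    have Kr: "real K = of_int \<lceil>\<delta> * n\<rceil>"
      using n unfolding K_def by (subst of_nat_nat) linarith+
    have n0: "n > 0" using n by (cases n) auto
    have "\<delta> * n \<le> 1 * real n"
      using \<delta>1 by (intro mult_right_mono) auto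
    then have Kn: "K \<le> n" unfolding K_def by (simp add: nat_le_iff ceiling_le_iff)
    have "real K \<le> \<delta> * n + 1" unfolding Kr by linarith
    also have "\<dots> \<le> r * n"
    proof -
      have "\<delta> * n \<le> r / 2 * n" by (intro mult_right_mono) (auto simp: \<delta>_def)
      then show ?thesis using n by linarith
    qed
    finally have Kr2: "real K / n \<le> r" using n0 by (simp add: field_simps)
    have K0: "K > 0" using n unfolding K_def by simp
    have "\<theta> * (\<Sum>k<K. rise \<theta> k) = K * rise \<theta> K" by (rule sum_rise)
    also have "\<dots> \<le> C * (real K / n) powr \<theta> * (n * rise \<theta> n)" by (rule C(2)[OF K0 Kn])
    also have "\<dots> \<le> C * r powr \<theta> * (n * rise \<theta> n)"
      using Kr2 assms C r rise_pos[of \<theta> n]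
      by (intro mult_right_mono mult_left_mono powr_mono2) auto
    also have "\<dots> = \<theta> * (\<eta> * (n * rise \<theta> n))" using C r by (simp add: mult_ac)
    finally show "(\<Sum>k<nat \<lceil>\<delta> * n\<rceil>. rise \<theta> k) \<le> \<eta> * (n * rise \<theta> n)"
      using assms unfolding K_def by simp
  qed
qed

section \<open>Pairs of integers with a small least common multiple\<close>

lemma sum_inverse_squares_le:
  assumes "0 < G"
  shows "(\<Sum>g\<in>{G<..n}. 1 / (real g)\<^sup>2) \<le> 1 / G"
proof -
  have "(\<Sum>g\<in>{G<..n}. 1 / (real g)\<^sup>2) \<le> 1 / G - 1 / n" if "G \<le> n"
    using that
  proof (induction n rule: dec_induct)
    case (step m)
    then have m: "m > 0" using assms by simp
    have "{G<..Suc m} = insert (Suc m) {G<..m}" using step by auto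
    \<comment> \<open>The telescoping comparison 1/(m+1)^2 \<le> 1/(m (m+1)).\<close>
    moreover have "1 / (real (Suc m))\<^sup>2 \<le> 1 / m - 1 / Suc m"
      using m by (simp add: divide_simps power2_eq_square)
    ultimately show ?case using step.IH by simp
  qed simp
  moreover have "{G<..n} = {}" if "\<not> G \<le> n" using that by auto
  ultimately show ?thesis
    by (cases "G \<le> n") (auto intro: order_trans)
qed

lemma card_multiples_le: "card {a \<in> {1..n}. g dvd a} \<le> n div g"
proof (cases "g = 0")
  case False
  have "{a \<in> {1..n}. g dvd a} \<subseteq> (\<lambda>k. g * k) ` {1..n div g}"
  proof
    fix a assume "a \<in> {a \<in> {1..n}. g dvd a}"
    then obtain k where k: "a = g * k" "1 \<le> a" "a \<le> n" by (auto elim: dvdE)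
    then have "k \<le> n div g" "1 \<le> k"
      using False by (auto simp: less_eq_div_iff_mult_less_eq mult_ac Suc_le_eq intro: Nat.gr0I)
    with k show "a \<in> (\<lambda>k. g * k) ` {1..n div g}" by auto
  qed
  from surj_card_le[OF _ this] show ?thesis by simp
\<comment> \<open>For g = 0 the set is empty, and \<open>n div 0\<close> is 0.\<close>
qed (auto intro: card_eq_0_iff[THEN iffD2])

text \<open>If neither a nor b is at most n/G, then a b > n^2/G^2, so an lcm below n^2/G^3 forces
  gcd a b > G. The two strips a \<le> n/G and b \<le> n/G contain at most n^2/G pairs each. At most
  (n/g)^2 pairs have both entries divisible by g, and the sum over g > G is again at most
  n^2/G.\<close>

lemma card_pairs_small_lcm_le:
  fixes G n :: nat
  assumes "0 < G"
  shows "real (card {(a, b). a \<in> {1..n} \<and> b \<in> {1..n} \<and> lcm a b * G ^ 3 < n\<^sup>2}) \<le> 3 * real n ^ 2 / G"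
proof (cases "n = 0")
  case False
  let ?A = "{1..n div G}" let ?N = "{1..n}"
  let ?D = "\<lambda>g. {a \<in> ?N. g dvd a}"
  have "{(a, b). a \<in> ?N \<and> b \<in> ?N \<and> lcm a b * G ^ 3 < n\<^sup>2} \<subseteq>
    ?A \<times> ?N \<union> ?N \<times> ?A \<union> (\<Union>g\<in>{G<..n}. ?D g \<times> ?D g)"
    (is "_ \<subseteq> ?U")
  proof (rule subsetI, rule ccontr)
    fix x assume "x \<in> {(a, b). a \<in> ?N \<and> b \<in> ?N \<and> lcm a b * G ^ 3 < n\<^sup>2}" "x \<notin> ?U"
    then obtain a b where 1: "a \<in> ?N" "b \<in> ?N" "lcm a b * G ^ 3 < n\<^sup>2" and "(a, b) \<notin> ?U"
      by blast
    then have ab: "n < a * G" "n < b * G"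
      using assms by (auto simp: less_eq_div_iff_mult_less_eq not_le)
    let ?g = "gcd a b"
    have "n * n \<le> (a * G) * (b * G)" using ab by (intro mult_mono) auto
    then have "G * n\<^sup>2 \<le> ?g * lcm a b * G ^ 3"
      by (simp add: prod_gcd_lcm_nat[symmetric] power2_eq_square power3_eq_cube mult_ac)
    also have "\<dots> = ?g * (lcm a b * G ^ 3)" by (rule mult.assoc)
    also have "?g * (lcm a b * G ^ 3) < ?g * n\<^sup>2"
      using 1 by (intro mult_strict_left_mono) auto
    finally have "G * n\<^sup>2 < ?g * n\<^sup>2" .
    then have "G < ?g" by simp
    moreover have "?g \<le> n" using 1 by (auto intro: order_trans[OF gcd_le1_nat])
    ultimately have "(a, b) \<in> ?U" using 1 by auto
    with \<open>(a, b) \<notin> ?U\<close> show False by contradiction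
  qed
  then have "card {(a, b). a \<in> ?N \<and> b \<in> ?N \<and> lcm a b * G ^ 3 < n\<^sup>2} \<le>
      card (?A \<times> ?N \<union> ?N \<times> ?A \<union> (\<Union>g\<in>{G<..n}. ?D g \<times> ?D g))"
    by (intro card_mono) auto
  also have "\<dots> \<le> card (?A \<times> ?N) + card (?N \<times> ?A) + (\<Sum>g\<in>{G<..n}. card (?D g \<times> ?D g))"
    by (intro order_trans[OF card_Un_le] add_mono card_UN_le order_refl) auto
  also have "\<dots> \<le> (n div G) * n + (n div G) * n + (\<Sum>g\<in>{G<..n}. (n div g) * (n div g))"
    by (intro add_mono sum_mono; simp only: card_cartesian_product;
        (rule mult_mono[OF card_multiples_le card_multiples_le])?; simp)
  finally have "real (card {(a, b). a \<in> ?N \<and> b \<in> ?N \<and> lcm a b * G ^ 3 < n\<^sup>2}) \<le>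
      real ((n div G) * n + (n div G) * n + (\<Sum>g\<in>{G<..n}. (n div g) * (n div g)))"
    by (rule of_nat_mono)
  also have "\<dots> = 2 * (real (n div G) * n) + (\<Sum>g\<in>{G<..n}. real (n div g) * real (n div g))"
    by simp
  also have "\<dots> \<le> 2 * (n / G * n) + (\<Sum>g\<in>{G<..n}. (n / g) * (n / g))"
    by (intro add_mono mult_left_mono mult_right_mono sum_mono mult_mono of_nat_div_le_of_nat) auto
  also have "(\<Sum>g\<in>{G<..n}. (real n / g) * (real n / g)) = n\<^sup>2 * (\<Sum>g\<in>{G<..n}. 1 / (real g)\<^sup>2)"
    by (simp add: sum_distrib_left power2_eq_square)
  also have "\<dots> \<le> n\<^sup>2 * (1 / G)"
    by (intro mult_left_mono sum_inverse_squares_le assms) auto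
  finally show ?thesis using assms by (simp add: power2_eq_square field_simps)
qed simp

section \<open>Exploring two cycles under the Ewens weight\<close>

abbreviation cycle_len :: "('a \<Rightarrow> 'a) \<Rightarrow> 'a \<Rightarrow> nat" where
  "cycle_len p i \<equiv> card (orbit p i)"

text \<open>The second exploration; \<open>a\<close> stands for the length of the cycle removed
  before. The condition is weakened to the cycle of a single point, of length n - m, and the m
  points left after it contribute their total weight.\<close>

lemma ewens_lcm_with_le:
  assumes "0 < \<theta>" "finite S" "S \<noteq> {}"
  defines "n \<equiv> card S"
  shows "(\<Sum>p | p permutes S. \<theta> ^ card (orbit p ` S) * of_bool (\<forall>j\<in>S. real (lcm a (cycle_len p j)) < h))
     \<le> \<theta> * fact (n - 1) * (\<Sum>m<n. rise \<theta> m * of_bool (real (lcm a (n - m)) < h))"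
proof -
  obtain x where x: "x \<in> S" using assms by auto
  let ?F = "\<lambda>T _. of_bool (real (lcm a (card T)) < h) :: real"
  let ?g = "\<lambda>m. \<theta> * of_bool (real (lcm a (n - m)) < h) * pochhammer \<theta> m"
  have "(\<Sum>p | p permutes S. \<theta> ^ card (orbit p ` S) * of_bool (\<forall>j\<in>S. real (lcm a (cycle_len p j)) < h))
      \<le> (\<Sum>p | p permutes S. \<theta> ^ card (orbit p ` S) *
            ?F (orbit p x) (perm_restrict p (S - orbit p x)))"
    using x assms by (intro sum_mono mult_left_mono) auto
  also have "\<dots> \<le> (\<Sum>T | x \<in> T \<and> T \<subseteq> S. \<theta> * fact (card T - 1) *
            (\<Sum>q | q permutes S - T. \<theta> ^ card (orbit q ` (S - T)) * ?F T q))"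
    using assms x by (intro sum_permutes_split_cycle) auto
  also have "\<dots> \<le> (\<Sum>T | x \<in> T \<and> T \<subseteq> S. fact (card T - 1) * ?g (n - card T))"
  proof (rule sum_mono)
    fix T assume T: "T \<in> {T. x \<in> T \<and> T \<subseteq> S}"
    then have c: "card (S - T) = n - card T" "card T \<le> n" "finite T"
      using assms by (auto simp: card_Diff_subset finite_subset intro: card_mono)
    have "(\<Sum>q | q permutes S - T. \<theta> ^ card (orbit q ` (S - T))) \<le> pochhammer \<theta> (n - card T)"
      using ewens_total_le[of "S - T" \<theta>] assms c by simp
    then have "\<theta> * fact (card T - 1) * (?F T id *
         (\<Sum>q | q permutes S - T. \<theta> ^ card (orbit q ` (S - T))))
       \<le> \<theta> * fact (card T - 1) * (?F T id * pochhammer \<theta> (n - card T))"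
      using assms by (intro mult_left_mono) auto
    also have "\<dots> = fact (card T - 1) * ?g (n - card T)"
      using c by simp
    finally show "\<theta> * fact (card T - 1) *
            (\<Sum>q | q permutes S - T. \<theta> ^ card (orbit q ` (S - T)) * ?F T q)
        \<le> fact (card T - 1) * ?g (n - card T)"
      by (simp add: sum_distrib_left mult_ac)
  qed
  also have "\<dots> = (\<Sum>k<n. fact (n - 1) / fact k * ?g k)"
    using sum_subsets_containing[OF assms(2) x, of ?g] by (simp add: n_def)
  also have "\<dots> = \<theta> * fact (n - 1) * (\<Sum>m<n. rise \<theta> m * of_bool (real (lcm a (n - m)) < h))"
    by (simp add: sum_distrib_left rise_def mult_ac)
  finally show ?thesis .
qed

text \<open>The first exploration: k points lie outside the first cycle and m outside both, so the
  two lengths are n - k and k - m. For k < \<open>K\<close> the lcm condition is dropped; otherwise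
  \<open>ewens_lcm_with_le\<close> is applied to the remaining points.\<close>

lemma ewens_all_lcm_le:
  assumes "0 < \<theta>" "finite S" "S \<noteq> {}" "0 < K"
  defines "n \<equiv> card S"
  shows "(\<Sum>p | p permutes S. \<theta> ^ card (orbit p ` S) *
            of_bool (\<forall>i\<in>S. \<forall>j\<in>S. real (lcm (cycle_len p i) (cycle_len p j)) < h))
     \<le> \<theta> * fact (n - 1) * (\<Sum>k<n. if k < K then rise \<theta> k
            else \<theta> / k * (\<Sum>m<k. rise \<theta> m * of_bool (real (lcm (n - k) (k - m)) < h)))"
proof -
  obtain x where x: "x \<in> S" using assms by auto
  let ?F = "\<lambda>T q. of_bool (\<forall>j\<in>S - T. real (lcm (card T) (cycle_len q j)) < h) :: real"
  define g where "g k = (if k < K then pochhammer \<theta> k else \<theta> * fact (k - 1) *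
      (\<Sum>m<k. rise \<theta> m * of_bool (real (lcm (n - k) (k - m)) < h)))" for k
  \<comment> \<open>Off the orbit of \<open>x\<close>, the cycles of \<open>p\<close> are those of
    its restriction, so the condition can be tested on the remaining permutation.\<close>
  have "(\<Sum>p | p permutes S. \<theta> ^ card (orbit p ` S) *
            of_bool (\<forall>i\<in>S. \<forall>j\<in>S. real (lcm (cycle_len p i) (cycle_len p j)) < h))
      \<le> (\<Sum>p | p permutes S. \<theta> ^ card (orbit p ` S) *
            ?F (orbit p x) (perm_restrict p (S - orbit p x)))"
    using x assms orbit_perm_restrict[of _ S _ x] by (intro sum_mono mult_left_mono) auto
  also have "\<dots> \<le> (\<Sum>T | x \<in> T \<and> T \<subseteq> S. \<theta> * fact (card T - 1) *
            (\<Sum>q | q permutes S - T. \<theta> ^ card (orbit q ` (S - T)) * ?F T q))"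
    using assms x by (intro sum_permutes_split_cycle) auto
  also have "\<dots> \<le> (\<Sum>T | x \<in> T \<and> T \<subseteq> S. \<theta> * fact (card T - 1) * g (n - card T))"
  proof (intro sum_mono mult_left_mono)
    fix T assume T: "T \<in> {T. x \<in> T \<and> T \<subseteq> S}"
    then have c: "card (S - T) = n - card T" "card T \<le> n" "finite T"
      using assms by (auto simp: card_Diff_subset finite_subset intro: card_mono)
    show "(\<Sum>q | q permutes S - T. \<theta> ^ card (orbit q ` (S - T)) * ?F T q) \<le> g (n - card T)"
    proof (cases "n - card T < K")
      case True
      have "(\<Sum>q | q permutes S - T. \<theta> ^ card (orbit q ` (S - T)) * ?F T q)
        \<le> (\<Sum>q | q permutes S - T. \<theta> ^ card (orbit q ` (S - T)))"
        using assms by (intro sum_mono) auto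
      also have "\<dots> \<le> pochhammer \<theta> (n - card T)"
        using ewens_total_le[of "S - T" \<theta>] assms c by simp
      finally show ?thesis using True by (simp add: g_def)
    next
      case False
      \<comment> \<open>\<open>K\<close> > 0 guarantees that a point is left from which to start a
        second cycle.\<close>
      then have "card (S - T) > 0" using c \<open>0 < K\<close> by simp
      then have "S - T \<noteq> {}" by (auto simp: card_gt_0_iff)
      from ewens_lcm_with_le[OF \<open>0 < \<theta>\<close> _ this, of "card T" h] show ?thesis
        using False c assms(2) by (simp add: g_def)
    qed
  qed (use assms in auto)
  also have "\<dots> = \<theta> * (\<Sum>T | x \<in> T \<and> T \<subseteq> S. fact (card T - 1) * g (card S - card T))"
    by (simp add: sum_distrib_left mult_ac n_def)
  also have "\<dots> = \<theta> * (\<Sum>k<n. fact (n - 1) / fact k * g k)"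
    by (subst sum_subsets_containing[OF assms(2) x, of g]) (simp add: n_def)
  also have "(\<Sum>k<n. fact (n - 1) / fact k * g k) = fact (n - 1) * (\<Sum>k<n. if k < K then rise \<theta> k
            else \<theta> / k * (\<Sum>m<k. rise \<theta> m * of_bool (real (lcm (n - k) (k - m)) < h)))"
    unfolding sum_distrib_left[where r = "fact (n - 1)"]
  proof (rule sum.cong[OF refl], goal_cases)
    case (1 k)
    show ?case
    proof (cases "k < K")
      case False
      \<comment> \<open>The factor (k-1)! of the second exploration meets 1 / k! of the first; this
        is the origin of \<theta> / k.\<close>
      then have "fact (k - 1) / fact k = (1 / k :: real)"
        using \<open>0 < K\<close> by (subst (2) fact_reduce) auto
      then have "fact (n - 1) / fact k * (\<theta> * fact (k - 1) * X) = fact (n - 1) * (\<theta> / k * X)" for X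
        by (simp add: field_simps)
      with False show ?thesis by (simp only: g_def if_False)
    qed (simp add: g_def rise_def)
  qed
  finally show ?thesis by (simp only: mult.assoc)
qed

text \<open>For m < \<open>K\<close> the indicator is bounded by 1. For m \<ge> \<open>K\<close>
  \<ge> \<delta> n the weight \<open>rise \<theta> m\<close> is at most
  \<open>rise \<theta> n\<close> / \<delta>, a bound free of k and m, and what remains is to count
  pairs of lengths with a small lcm.\<close>

lemma sum_rise_pairs_le:
  fixes n G K :: nat and \<delta> :: real
  assumes "0 < \<theta>" "0 < G" "0 < \<delta>" "\<delta> \<le> 1" "\<delta> * n \<le> K"
  shows "(\<Sum>k<n. \<Sum>m<k. rise \<theta> m * of_bool (real (lcm (n - k) (k - m)) < n ^ 2 / G ^ 3))
     \<le> n * (\<Sum>m<K. rise \<theta> m) + rise \<theta> n / \<delta> * (3 * real n ^ 2 / G)"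
proof -
  let ?b = "\<lambda>k m. of_bool (real (lcm (n - k) (k - m)) < n ^ 2 / G ^ 3) :: real"
  let ?P = "SIGMA k:{..<n}. {..<k}"
  let ?L = "{(a, b). a \<in> {1..n} \<and> b \<in> {1..n} \<and> lcm a b * G ^ 3 < n\<^sup>2}"
  have pos: "0 \<le> rise \<theta> m" for m using rise_pos[OF assms(1)] less_imp_le by blast
  have le: "rise \<theta> m * ?b k m \<le> (if m < K then rise \<theta> m else 0) + rise \<theta> n / \<delta> * ?b k m"
    if "k < n" "m < k" for k m
  proof (cases "m < K")
    case True
    have "rise \<theta> m * ?b k m \<le> rise \<theta> m * 1"
      using pos by (intro mult_left_mono) auto
    moreover have "0 \<le> rise \<theta> n / \<delta> * ?b k m"
      using pos[of n] assms by simp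
    ultimately show ?thesis using True by (simp only: if_True)
  next
    case False
    then have "real K \<le> real m" by simp
    then have "\<delta> * n \<le> m" using assms by linarith
    moreover have "\<delta> * \<theta> \<le> \<theta>" using assms by simp
    \<comment> \<open>With this, \<open>rise_mono\<close> compares \<open>rise \<theta> m\<close>
      and \<open>rise \<theta> n\<close> at the cost of a factor 1 / \<delta>.\<close>
    ultimately have d: "\<delta> * (\<theta> + n) \<le> \<theta> + m" by (simp add: distrib_left)
    have "rise \<theta> m * (\<delta> * (\<theta> + n)) \<le> rise \<theta> m * (\<theta> + m)"
      by (rule mult_left_mono[OF d pos])
    also have "\<dots> \<le> (\<theta> + n) * rise \<theta> n"
      using rise_mono[OF assms(1), of m n] that by (simp add: mult_ac)
    finally have "(\<theta> + n) * (rise \<theta> m * \<delta>) \<le> (\<theta> + n) * rise \<theta> n"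
      by (simp add: mult_ac)
    then have "rise \<theta> m * \<delta> \<le> rise \<theta> n" using assms by simp
    then have "rise \<theta> m \<le> rise \<theta> n / \<delta>" using assms by (simp add: field_simps)
    then show ?thesis using False by simp
  qed
  have "(\<Sum>k<n. \<Sum>m<k. rise \<theta> m * ?b k m)
     \<le> (\<Sum>k<n. \<Sum>m<k. (if m < K then rise \<theta> m else 0) + rise \<theta> n / \<delta> * ?b k m)"
    using le by (intro sum_mono) auto
  also have "\<dots> = (\<Sum>k<n. \<Sum>m<k. if m < K then rise \<theta> m else 0) + rise \<theta> n / \<delta> * (\<Sum>k<n. \<Sum>m<k. ?b k m)"
    by (simp only: sum.distrib sum_distrib_left)
  also have "(\<Sum>k<n. \<Sum>m<k. if m < K then rise \<theta> m else 0) \<le> (\<Sum>k<n. \<Sum>m<K. rise \<theta> m)"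
  proof (rule sum_mono)
    fix k
    have "(\<Sum>m<k. if m < K then rise \<theta> m else 0) = (\<Sum>m\<in>{..<k} \<inter> {..<K}. rise \<theta> m)"
      by (subst sum.inter_restrict) auto
    also have "\<dots> \<le> (\<Sum>m<K. rise \<theta> m)"
      using pos by (intro sum_mono2) auto
    finally show "(\<Sum>m<k. if m < K then rise \<theta> m else 0) \<le> (\<Sum>m<K. rise \<theta> m)" .
  qed
  also have "(\<Sum>k<n. \<Sum>m<K. rise \<theta> m) = n * (\<Sum>m<K. rise \<theta> m)" by simp
  also have "(\<Sum>k<n. \<Sum>m<k. ?b k m) = (\<Sum>(k, m)\<in>?P. ?b k m)"
    by (subst sum.Sigma) auto
  also have "\<dots> = real (card (?P \<inter> {(k, m). real (lcm (n - k) (k - m)) < n ^ 2 / G ^ 3}))"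
    by (simp add: case_prod_unfold of_bool_def sum.If_cases flip: sum.inter_filter)
  also have "\<dots> \<le> real (card ?L)"
  \<comment> \<open>Leftover sizes (k, m) are traded for cycle lengths (n - k, k - m), which
    determine them.\<close>
  proof (intro of_nat_mono card_inj_on_le[where f = "\<lambda>(k, m). (n - k, k - m)"])
    show "inj_on (\<lambda>(k, m). (n - k, k - m)) (?P \<inter> {(k, m). real (lcm (n - k) (k - m)) < n ^ 2 / G ^ 3})"
      by (auto simp: inj_on_def)
    show "(\<lambda>(k, m). (n - k, k - m)) ` (?P \<inter> {(k, m). real (lcm (n - k) (k - m)) < n ^ 2 / G ^ 3}) \<subseteq> ?L"
    proof safe
      fix k m assume *: "real (lcm (n - k) (k - m)) < n ^ 2 / G ^ 3"
      have "real (lcm (n - k) (k - m) * G ^ 3) < real (n ^ 2)"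
        using * assms by (simp add: field_simps)
      then show "lcm (n - k) (k - m) * G ^ 3 < n\<^sup>2" by (simp only: of_nat_less_iff)
    qed auto
    show "finite ?L" by (rule finite_subset[of _ "{1..n} \<times> {1..n}"]) auto
  qed
  also have "\<dots> \<le> 3 * real n ^ 2 / G" by (rule card_pairs_small_lcm_le[OF assms(2)])
  finally show ?thesis using pos assms by (simp add: mult_left_mono divide_right_mono)
qed

text \<open>Three error terms, each at most a third of the total: the first cycle leaves fewer than
  \<delta> n points, both cycles together leave fewer than \<gamma> n points, or the lengths form
  one of the few pairs with a small lcm.\<close>

lemma ewens_small_lcm:
  fixes \<theta> \<epsilon> :: real
  assumes "0 < \<theta>" "0 < \<epsilon>"
  obtains c :: real where "0 < c"
    and "\<And>n :: nat. 1 \<le> n \<Longrightarrow> (\<Sum>p | p permutes {..<n}. \<theta> ^ card (orbit p ` {..<n}) *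
            of_bool (\<forall>i<n. \<forall>j<n. real (lcm (cycle_len p i) (cycle_len p j)) < c * real n ^ 2))
     \<le> \<epsilon> * pochhammer \<theta> n"
proof -
  have "0 < \<epsilon> / (3 * \<theta>)" using assms by simp
  from sum_rise_initial_small[OF assms(1) this] obtain \<delta> :: real where \<delta>: "0 < \<delta>" "\<delta> \<le> 1"
    "\<And>n :: nat. 1 \<le> \<delta> * n \<Longrightarrow> (\<Sum>k<nat \<lceil>\<delta> * n\<rceil>. rise \<theta> k) \<le> \<epsilon> / (3 * \<theta>) * (n * rise \<theta> n)"
    by blast
  \<comment> \<open>The second error is multiplied by \<theta> / \<delta>, from \<theta> / k \<le>
    \<theta> / (\<delta> n) summed over n values of k; the tolerance for \<gamma> compensates
    this.\<close>
  have "0 < \<delta> * \<epsilon> / (3 * \<theta>\<^sup>2)" using assms \<delta> by simp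
  from sum_rise_initial_small[OF assms(1) this] obtain \<gamma> :: real where \<gamma>: "0 < \<gamma>" "\<gamma> \<le> 1"
    "\<And>n :: nat. 1 \<le> \<gamma> * n \<Longrightarrow> (\<Sum>k<nat \<lceil>\<gamma> * n\<rceil>. rise \<theta> k) \<le> \<delta> * \<epsilon> / (3 * \<theta>\<^sup>2) * (n * rise \<theta> n)"
    by blast
  \<comment> \<open>Chosen so that the third error, with coefficient 3 \<theta> / (\<delta> \<gamma>
    G), is at most \<epsilon> / (3 \<theta>).\<close>
  define G where "G = Suc (nat \<lceil>9 * \<theta>\<^sup>2 / (\<delta> * \<gamma> * \<epsilon>)\<rceil>)"
  have G: "0 < G" "9 * \<theta>\<^sup>2 / (\<delta> * \<gamma> * \<epsilon>) \<le> G" unfolding G_def by (simp, linarith)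
  \<comment> \<open>The first bound gives c n^2 \<le> n^2/G^3. The second settles small n: if n
    min(\<delta>, \<gamma>) < 1 then c n^2 \<le> 1, and no lcm of cycle lengths lies below
    1.\<close>
  define c where "c = min (1 / G ^ 3) ((min \<delta> \<gamma>)\<^sup>2)"
  show thesis
  proof (rule that[of c])
    show "0 < c" using \<delta> \<gamma> G by (simp add: c_def)
    fix n :: nat assume n: "1 \<le> n"
    let ?bad = "\<lambda>h p. of_bool (\<forall>i\<in>{..<n}. \<forall>j\<in>{..<n}. real (lcm (cycle_len p i) (cycle_len p j)) < h) :: real"
    let ?Z = "\<lambda>h. \<Sum>p | p permutes {..<n}. \<theta> ^ card (orbit p ` {..<n}) * ?bad h p"
    have pos: "0 \<le> rise \<theta> m" for m using rise_pos[OF assms(1)] less_imp_le by blast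
    have "?Z (c * real n ^ 2) \<le> \<epsilon> * pochhammer \<theta> n"
    proof (cases "1 \<le> min \<delta> \<gamma> * n")
      case False
      have "c * real n ^ 2 \<le> (min \<delta> \<gamma>)\<^sup>2 * real n ^ 2" unfolding c_def by (intro mult_right_mono) auto
      also have "\<dots> = (min \<delta> \<gamma> * n)\<^sup>2" by (simp add: power_mult_distrib)
      also have "\<dots> \<le> 1 ^ 2" using False \<delta> \<gamma> by (intro power_mono) auto
      finally have c1: "c * real n ^ 2 \<le> 1" by simp
      have "?bad (c * real n ^ 2) p = 0" if "p permutes {..<n}" for p
      proof -
        have "permutation p" using that permutation_permutes by blast
        then have "1 \<le> lcm (cycle_len p 0) (cycle_len p 0)"
          using orbit_enum(1)[of p 0] by simp
        then have "\<not> real (lcm (cycle_len p 0) (cycle_len p 0)) < c * real n ^ 2"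
          using c1 by linarith
        moreover have "0 \<in> {..<n}" using n by simp
        ultimately show ?thesis by (simp only: of_bool_eq_0_iff) blast
      qed
      then have "?Z (c * real n ^ 2) = 0"
        by (intro sum.neutral ballI) (simp only: mem_Collect_eq mult_zero_right)
      then show ?thesis using assms by (simp add: pochhammer_nonneg)
    next
      case True
      then have n\<delta>: "1 \<le> \<delta> * n" and n\<gamma>: "1 \<le> \<gamma> * n"
        using \<delta> \<gamma> n by (auto simp: min_mult_distrib_right)
      define K where "K = nat \<lceil>\<delta> * n\<rceil>"
      define K' where "K' = nat \<lceil>\<gamma> * n\<rceil>"
      have K: "0 < K" "\<delta> * n \<le> K" and K': "\<gamma> * n \<le> K'"
        using n\<delta> unfolding K_def K'_def by (simp, linarith, linarith)
      define h where "h = real (n ^ 2) / real (G ^ 3)"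
      let ?b = "\<lambda>k m. of_bool (real (lcm (n - k) (k - m)) < h) :: real"
      have inner: "0 \<le> (\<Sum>m<k. rise \<theta> m * ?b k m)" for k using pos by (intro sum_nonneg) auto
      have ch: "c * real n ^ 2 \<le> h"
      proof -
        have "c * real n ^ 2 \<le> 1 / G ^ 3 * real n ^ 2" unfolding c_def by (intro mult_right_mono) auto
        then show ?thesis by (simp add: h_def)
      qed
      have "?Z (c * real n ^ 2) \<le> ?Z h"
        using assms ch by (intro sum_mono mult_left_mono) (auto intro: less_le_trans)
      also have "\<dots> \<le> \<theta> * fact (n - 1) * (\<Sum>k<n. if k < K then rise \<theta> k
            else \<theta> / k * (\<Sum>m<k. rise \<theta> m * ?b k m))"
      proof -
        have "{..<n} \<noteq> {}" using n by (simp add: lessThan_empty_iff)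
        from ewens_all_lcm_le[OF assms(1) finite_lessThan this K(1), of h]
        show ?thesis unfolding card_lessThan .
      qed
      also have "\<dots> \<le> \<theta> * fact (n - 1) * (\<epsilon> / \<theta> * (n * rise \<theta> n))"
      proof (rule mult_left_mono)
        have "(\<Sum>k<n. if k < K then rise \<theta> k else \<theta> / k * (\<Sum>m<k. rise \<theta> m * ?b k m))
          \<le> (\<Sum>k<n. (if k < K then rise \<theta> k else 0) + \<theta> / (\<delta> * n) * (\<Sum>m<k. rise \<theta> m * ?b k m))"
        proof (rule sum_mono)
          fix k
          show "(if k < K then rise \<theta> k else \<theta> / k * (\<Sum>m<k. rise \<theta> m * ?b k m))
            \<le> (if k < K then rise \<theta> k else 0) + \<theta> / (\<delta> * n) * (\<Sum>m<k. rise \<theta> m * ?b k m)"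
          proof (cases "k < K")
            case True
            then show ?thesis using inner[of k] assms \<delta> by simp
          next
            case False
            then have "\<delta> * n \<le> k" using K by linarith
            then have "\<theta> / k \<le> \<theta> / (\<delta> * n)" using assms n\<delta> by (intro divide_left_mono) auto
            from mult_right_mono[OF this inner[of k]] show ?thesis
              using False by (simp only: if_False add_0_left)
          qed
        qed
        also have "\<dots> = (\<Sum>k<n. if k < K then rise \<theta> k else 0)
            + \<theta> / (\<delta> * n) * (\<Sum>k<n. \<Sum>m<k. rise \<theta> m * ?b k m)"
          by (simp only: sum.distrib sum_distrib_left)
        also have "(\<Sum>k<n. if k < K then rise \<theta> k else 0) = (\<Sum>k\<in>{..<n} \<inter> {..<K}. rise \<theta> k)"
          by (subst sum.inter_restrict) auto
        also have "\<dots> \<le> (\<Sum>k<K. rise \<theta> k)" using pos by (intro sum_mono2) auto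
        also have "\<dots> \<le> \<epsilon> / (3 * \<theta>) * (n * rise \<theta> n)" unfolding K_def by (rule \<delta>(3)[OF n\<delta>])
        also have "\<theta> / (\<delta> * n) * (\<Sum>k<n. \<Sum>m<k. rise \<theta> m * ?b k m)
          \<le> \<theta> / (\<delta> * n) * (n * (\<delta> * \<epsilon> / (3 * \<theta>\<^sup>2) * (n * rise \<theta> n))
              + rise \<theta> n / \<gamma> * (3 * real n ^ 2 / G))"
        proof (rule mult_left_mono)
          have "(\<Sum>k<n. \<Sum>m<k. rise \<theta> m * ?b k m)
             \<le> n * (\<Sum>m<K'. rise \<theta> m) + rise \<theta> n / \<gamma> * (3 * real n ^ 2 / G)"
            using sum_rise_pairs_le[OF assms(1) G(1) \<gamma>(1,2) K'] by (simp add: h_def)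
          also have "n * (\<Sum>m<K'. rise \<theta> m) \<le> n * (\<delta> * \<epsilon> / (3 * \<theta>\<^sup>2) * (n * rise \<theta> n))"
            unfolding K'_def by (intro mult_left_mono \<gamma>(3)[OF n\<gamma>]) auto
          finally show "(\<Sum>k<n. \<Sum>m<k. rise \<theta> m * ?b k m)
            \<le> n * (\<delta> * \<epsilon> / (3 * \<theta>\<^sup>2) * (n * rise \<theta> n)) + rise \<theta> n / \<gamma> * (3 * real n ^ 2 / G)"
            by simp
        qed (use assms \<delta> in auto)
        also have "\<dots> = \<epsilon> / (3 * \<theta>) * (n * rise \<theta> n) + 3 * \<theta> / (\<delta> * \<gamma> * G) * (n * rise \<theta> n)"
          using n assms \<delta> \<gamma> G(1) by (simp add: divide_simps power2_eq_square) (simp add: algebra_simps)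
        also have "3 * \<theta> / (\<delta> * \<gamma> * G) * (n * rise \<theta> n) \<le> \<epsilon> / (3 * \<theta>) * (n * rise \<theta> n)"
        proof (rule mult_right_mono)
          show "3 * \<theta> / (\<delta> * \<gamma> * G) \<le> \<epsilon> / (3 * \<theta>)"
            using G assms \<delta> \<gamma> by (simp add: divide_simps power2_eq_square mult_ac)
        qed (use pos in auto)
        finally show "(\<Sum>k<n. if k < K then rise \<theta> k else \<theta> / k * (\<Sum>m<k. rise \<theta> m * ?b k m))
          \<le> \<epsilon> / \<theta> * (n * rise \<theta> n)"
          by (simp add: field_simps)
      qed (use assms in auto)
      also have "\<dots> = \<epsilon> * pochhammer \<theta> n"
        using pochhammer_eq_rise[of n \<theta>] n assms by simp
      finally show ?thesis .
    qed
    then show "(\<Sum>p | p permutes {..<n}. \<theta> ^ card (orbit p ` {..<n}) *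
            of_bool (\<forall>i<n. \<forall>j<n. real (lcm (cycle_len p i) (cycle_len p j)) < c * real n ^ 2))
     \<le> \<epsilon> * pochhammer \<theta> n" by (simp add: Ball_def)
  qed
qed

section \<open>Eigenangles and spacings\<close>

lemma funpow_permutes_in: "p permutes S \<Longrightarrow> x \<in> S \<Longrightarrow> (p ^^ k) x \<in> S"
  by (induction k) (auto simp: permutes_in_image)

text \<open>The listing starts at \<open>p i\<close>, not at \<open>i\<close>, because running
  through the cycle from \<open>i\<close> collects the phases of \<open>p i\<close>,
  \<open>p (p i)\<close>, ... in this order.\<close>

lemma prod_orbit:
  assumes "permutation p"
  shows "(\<Prod>j\<in>orbit p i. f j) = (\<Prod>k<cycle_len p i. f ((p ^^ Suc k) i))"
proof -
  have o: "orbit p (p i) = orbit p i" by (rule permutation_orbit_step[OF assms])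
  note enum = orbit_enum(3,4)[OF assms, of "p i", unfolded o]
  have "(\<Prod>j\<in>orbit p i. f j) = (\<Prod>k<cycle_len p i. f ((p ^^ k) (p i)))"
    by (subst enum(2), subst prod.reindex[OF enum(1)]) simp
  then show ?thesis by (simp add: funpow_swap1)
qed

lemma phase_perm_matrix_mult_vec:
  assumes "p permutes {..<n}" "v \<in> carrier_vec n" "j < n"
  shows "vec_index (phase_perm_matrix n p z *\<^sub>v v) (p j) = z (p j) * vec_index v j"
proof -
  have pj: "p j < n" using assms by (metis lessThan_iff permutes_in_image)
  have "vec_index (phase_perm_matrix n p z *\<^sub>v v) (p j) = (\<Sum>k = 0..<n. z (p j) * of_bool (p j = p k) * vec_index v k)"
    using assms pj by (simp add: phase_perm_matrix_def scalar_prod_def)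
  also have "\<dots> = (\<Sum>k = 0..<n. if k = j then z (p j) * vec_index v k else 0)"
    using inj_eq[OF permutes_inj[OF assms(1)]] by (intro sum.cong) auto
  also have "\<dots> = z (p j) * vec_index v j" using assms by simp
  finally show ?thesis .
qed

text \<open>An eigenvector satisfies \<mu> v(p j) = z(p j) v(j). Following this once around a cycle
  on which v does not vanish gives the equation; conversely the equation lets the recursion close up
  to an eigenvector supported on that cycle.\<close>

lemma eigenvalue_phase_perm_matrix_iff:
  assumes p: "p permutes {..<n}" and "\<mu> \<noteq> 0"
  shows "eigenvalue (phase_perm_matrix n p z) \<mu> \<longleftrightarrow>
    (\<exists>i<n. \<mu> ^ cycle_len p i = (\<Prod>j\<in>orbit p i. z j))"
proof
  let ?A = "phase_perm_matrix n p z"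
  have perm: "permutation p" using p permutation_permutes by blast
  have dim: "dim_row ?A = n" "dim_col ?A = n" by (simp_all add: phase_perm_matrix_def)
  {
    assume "eigenvalue ?A \<mu>"
    then obtain v where v: "v \<in> carrier_vec n" "v \<noteq> 0\<^sub>v n" "?A *\<^sub>v v = \<mu> \<cdot>\<^sub>v v"
      unfolding eigenvalue_def eigenvector_def dim by auto
    then obtain i where i: "i < n" "vec_index v i \<noteq> 0" by (metis carrier_vecD eq_vecI index_zero_vec)
    have step: "\<mu> * vec_index v (p j) = z (p j) * vec_index v j" if "j < n" for j
      using phase_perm_matrix_mult_vec[OF p v(1) that, of z] v that
      by (metis carrier_vecD index_smult_vec(1) lessThan_iff p permutes_in_image)
    have iter: "\<mu> ^ k * vec_index v ((p ^^ k) i) = (\<Prod>m<k. z ((p ^^ Suc m) i)) * vec_index v i" for k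
    proof (induction k)
      case (Suc k)
      have "(p ^^ k) i < n" using funpow_permutes_in[OF p, of i k] i by simp
      from step[OF this] have "\<mu> ^ Suc k * vec_index v ((p ^^ Suc k) i) = z ((p ^^ Suc k) i) * (\<mu> ^ k * vec_index v ((p ^^ k) i))"
        by (simp add: mult_ac)
      with Suc show ?case by (simp add: mult_ac)
    qed simp
    from iter[of "cycle_len p i"] have "\<mu> ^ cycle_len p i = (\<Prod>j\<in>orbit p i. z j)"
      using orbit_enum(2)[OF perm, of i] i unfolding prod_orbit[OF perm] by simp
    then show "\<exists>i<n. \<mu> ^ cycle_len p i = (\<Prod>j\<in>orbit p i. z j)" using i by blast
  next
    assume "\<exists>i<n. \<mu> ^ cycle_len p i = (\<Prod>j\<in>orbit p i. z j)"
    then obtain i where i: "i < n" "\<mu> ^ cycle_len p i = (\<Prod>j\<in>orbit p i. z j)" by blast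
    define L where "L = cycle_len p i"
    \<comment> \<open>The value of the eigenvector at the k-th point of the cycle, normalised to 1
      at \<open>i\<close>; \<open>f\<close> reads k off the point and is 0 elsewhere.\<close>
    define V where "V k = (\<Prod>m<k. z ((p ^^ Suc m) i)) / \<mu> ^ k" for k
    define f where "f x = (if x \<in> orbit p i then V (inv_into {..<L} (\<lambda>k. (p ^^ k) i) x) else 0)" for x
    note enum = orbit_enum[OF perm, of i, folded L_def]
    have "(\<Prod>m<L. z ((p ^^ Suc m) i)) = \<mu> ^ L"
      using i(2) unfolding prod_orbit[OF perm] L_def by (rule sym)
    then have "V L = 1" using \<open>\<mu> \<noteq> 0\<close> unfolding V_def by simp
    moreover have "V 0 = 1" by (simp add: V_def)
    moreover have f_lt: "f ((p ^^ k) i) = V k" if "k < L" for k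
    proof -
      have "inv_into {..<L} (\<lambda>k. (p ^^ k) i) ((p ^^ k) i) = k"
        using that by (intro inv_into_f_f[OF enum(3)]) simp
      then show ?thesis using that enum(4) by (simp add: f_def)
    qed
    \<comment> \<open>The index k = \<open>L\<close> is included: the cycle equation gives
      \<open>V L = V 0\<close>, so the recursion also holds at the step back to
      \<open>i\<close>.\<close>
    ultimately have f_le: "f ((p ^^ k) i) = V k" if "k \<le> L" for k
      using that enum(1,2) f_lt[of 0] by (cases "k = L") auto
    have fp: "\<mu> * f (p x) = z (p x) * f x" for x
    proof (cases "x \<in> orbit p i")
      case True
      then obtain k where k: "k < L" "x = (p ^^ k) i" using enum(4) by auto
      have "\<mu> * V (Suc k) = z ((p ^^ Suc k) i) * V k"
        using \<open>\<mu> \<noteq> 0\<close> by (simp add: V_def)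
      then show ?thesis using f_le[of k] f_le[of "Suc k"] k by simp
    next
      case False
      have "p x \<notin> orbit p i"
        using False cyclic_on_f_in[OF p cyclic_on_orbit'[OF perm]] by blast
      with False show ?thesis by (simp add: f_def)
    qed
    let ?v = "Matrix.vec n f"
    have "?A *\<^sub>v ?v = \<mu> \<cdot>\<^sub>v ?v"
    proof (rule eq_vecI)
      fix y assume "y < dim_vec (\<mu> \<cdot>\<^sub>v ?v)"
      then have y: "y < n" by simp
      then obtain x where x: "x < n" "y = p x"
        using p by (metis lessThan_iff permutes_def permutes_in_image)
      show "vec_index (?A *\<^sub>v ?v) y = vec_index (\<mu> \<cdot>\<^sub>v ?v) y"
        using phase_perm_matrix_mult_vec[OF p, of ?v x z] fp[of x] x y by simp
    qed (simp add: dim)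
    moreover have "?v \<noteq> 0\<^sub>v n"
      using f_lt[of 0] enum(1) i(1) by (auto simp: V_def dest!: arg_cong[of _ _ "\<lambda>v. vec_index v i"])
    ultimately show "eigenvalue ?A \<mu>"
      unfolding eigenvalue_def eigenvector_def dim by (intro exI[of _ ?v]) simp
  }
qed

lemma eigenangles_phase_perm_matrix:
  assumes "p permutes {..<n}"
  shows "eigenangles (phase_perm_matrix n p z) =
    {t. \<exists>i<n. cis (cycle_len p i * t) = (\<Prod>j\<in>orbit p i. z j)}"
  unfolding eigenangles_def eigenvalue_phase_perm_matrix_iff[OF assms cis_neq_zero] Complex.DeMoivre ..

lemma perm_matrix_eq_phase: "perm_matrix n p = phase_perm_matrix n p (\<lambda>_. 1)"
  by (simp add: perm_matrix_def phase_perm_matrix_def)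

section \<open>Gaps of a periodic set of angles\<close>

lemma cis_eq_cis_iff: "cis x = cis y \<longleftrightarrow> (\<exists>k :: int. x = y + 2 * pi * k)"
  using sin_cos_eq_iff[of x y] by (auto simp: complex_eq_iff)

lemma finite_cis_eq_Icc:
  assumes "0 < L"
  shows "finite ({t. cis (L * t) = w} \<inter> {a..b})"
proof (cases "{t. cis (L * t) = w} \<inter> {a..b} = {}")
  case False
  then obtain t0 where t0: "cis (L * t0) = w" by auto
  have "{t. cis (L * t) = w} \<inter> {a..b} \<subseteq>
      (\<lambda>k :: int. t0 + 2 * pi * k / L) ` {\<lfloor>L * (a - t0) / (2 * pi)\<rfloor>..\<lceil>L * (b - t0) / (2 * pi)\<rceil>}"
  proof
    fix t assume t: "t \<in> {t. cis (L * t) = w} \<inter> {a..b}"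
    then obtain k :: int where k: "L * t = L * t0 + 2 * pi * k" using t0 cis_eq_cis_iff by auto
    then have "t = t0 + 2 * pi * k / L" "real_of_int k = L * (t - t0) / (2 * pi)"
      using assms by (simp_all add: field_simps)
    moreover have "L * (a - t0) / (2 * pi) \<le> L * (t - t0) / (2 * pi)"
      "L * (t - t0) / (2 * pi) \<le> L * (b - t0) / (2 * pi)"
      using t assms by (intro divide_right_mono mult_left_mono; simp)+
    ultimately show "t \<in> (\<lambda>k :: int. t0 + 2 * pi * k / L) `
        {\<lfloor>L * (a - t0) / (2 * pi)\<rfloor>..\<lceil>L * (b - t0) / (2 * pi)\<rceil>}"
      by (intro image_eqI[of _ _ k]) (auto, linarith+)
  qed
  then show ?thesis by (rule finite_subset) simp
qed simp

text \<open>Makes \<open>Min\<close> usable: the gaps form a finite nonempty set, and their minimum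
  is the least positive difference of any two elements, adjacent or not. Finiteness holds because a
  gap is at most 2 pi long and can be translated so as to start in [0, 2 pi]; every positive
  difference t - s dominates the gap starting at s.\<close>

lemma Min_gaps:
  fixes E :: "real set"
  defines "G \<equiv> {t - s | s t. s \<in> E \<and> t \<in> E \<and> s < t \<and> {s<..<t} \<inter> E = {}}"
  assumes ne: "E \<noteq> {}" and per: "\<And>t (k :: int). t \<in> E \<Longrightarrow> t + 2 * pi * k \<in> E"
    and fin: "\<And>a b. finite (E \<inter> {a..b})"
  shows "\<exists>s\<in>E. \<exists>t\<in>E. s < t \<and> Min G = t - s"
    and "\<And>s t. s \<in> E \<Longrightarrow> t \<in> E \<Longrightarrow> s < t \<Longrightarrow> Min G \<le> t - s"
proof -
  have "G \<subseteq> (\<lambda>(s, t). t - s) ` ((E \<inter> {0..2 * pi}) \<times> (E \<inter> {0..4 * pi}))"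
  proof
    fix g assume "g \<in> G"
    then obtain s t where st: "g = t - s" "s \<in> E" "t \<in> E" "s < t" "{s<..<t} \<inter> E = {}"
      by (auto simp: G_def)
    have "s + 2 * pi \<in> E" using per[OF st(2), of 1] by simp
    have le: "t \<le> s + 2 * pi"
    proof (rule ccontr)
      assume "\<not> t \<le> s + 2 * pi"
      then have "s + 2 * pi \<in> {s<..<t} \<inter> E" using \<open>s + 2 * pi \<in> E\<close> by simp
      with st show False by blast
    qed
    define k where "k = - \<lfloor>s / (2 * pi)\<rfloor>"
    have "real_of_int \<lfloor>s / (2 * pi)\<rfloor> \<le> s / (2 * pi)" "s / (2 * pi) \<le> real_of_int \<lfloor>s / (2 * pi)\<rfloor> + 1"
      by linarith+
    then have "2 * pi * real_of_int \<lfloor>s / (2 * pi)\<rfloor> \<le> 2 * pi * (s / (2 * pi))"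
      "2 * pi * (s / (2 * pi)) \<le> 2 * pi * (real_of_int \<lfloor>s / (2 * pi)\<rfloor> + 1)"
      by (intro mult_left_mono; simp)+
    then have s: "0 \<le> s + 2 * pi * k" "s + 2 * pi * k \<le> 2 * pi"
      by (simp_all add: k_def distrib_left)
    have "(s + 2 * pi * k, t + 2 * pi * k) \<in> (E \<inter> {0..2 * pi}) \<times> (E \<inter> {0..4 * pi})"
      using s st le per by auto
    then show "g \<in> (\<lambda>(s, t). t - s) ` ((E \<inter> {0..2 * pi}) \<times> (E \<inter> {0..4 * pi}))"
      using st by (intro image_eqI[of _ _ "(s + 2 * pi * k, t + 2 * pi * k)"]) auto
  qed
  then have finG: "finite G" by (rule finite_subset) (use fin in auto)
  have gap: "\<exists>g\<in>G. g \<le> t - s" if st: "s \<in> E" "t \<in> E" "s < t" for s t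
  proof -
    let ?F = "E \<inter> {s<..t}"
    have F: "finite ?F" "?F \<noteq> {}"
      using st by (auto intro: finite_subset[OF _ fin[of s t]])
    \<comment> \<open>The successor of \<open>s\<close> in \<open>E\<close>; local finiteness makes
      it exist.\<close>
    define u where "u = Min ?F"
    have u: "u \<in> ?F" "\<And>x. x \<in> ?F \<Longrightarrow> u \<le> x"
      unfolding u_def using Min_in[OF F] Min_le[OF F(1)] by blast+
    have "{s<..<u} \<inter> E = {}" using u(1) u(2) by fastforce
    then have "u - s \<in> G" 
      using u(1) st unfolding G_def by (intro CollectI exI[of _ s] exI[of _ u]) auto
    moreover have "u - s \<le> t - s" using u(1) by simp
    ultimately show ?thesis by blast
  qed
  obtain t where "t \<in> E" using ne by auto
  moreover have "t + 2 * pi \<in> E" using per[OF calculation, of 1] by simp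
  ultimately have "\<exists>g\<in>G. g \<le> t + 2 * pi - t" by (intro gap) simp_all
  then have "G \<noteq> {}" by blast
  from Min_in[OF finG this] obtain s t where "Min G = t - s" "s \<in> E" "t \<in> E" "s < t"
    unfolding G_def by blast
  then show "\<exists>s\<in>E. \<exists>t\<in>E. s < t \<and> Min G = t - s" by blast
  show "Min G \<le> t - s" if st: "s \<in> E" "t \<in> E" "s < t" for s t
  proof -
    obtain g where "g \<in> G" "g \<le> t - s" using gap[OF st] by blast
    then show ?thesis using Min_le[OF finG, of g] by simp
  qed
qed

lemma cycle_len_pos:
  fixes p :: "nat \<Rightarrow> nat"
  assumes "p permutes {..<n}"
  shows "0 < cycle_len p i"
proof -
  have "permutation p"
    unfolding permutation_permutes using assms by (intro exI[of _ "{..<n}"]) simp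
  then show ?thesis by (rule orbit_enum(1))
qed

lemma cycle_len_le:
  fixes p :: "nat \<Rightarrow> nat"
  assumes "p permutes {..<n}" "i < n"
  shows "cycle_len p i \<le> n"
proof -
  have "orbit p i \<subseteq> {..<n}"
    using permutes_orbit_subset[OF assms(1)] assms(2) by simp
  then have "card (orbit p i) \<le> card {..<n}" by (intro card_mono) auto
  then show ?thesis by simp
qed

lemma prod_eq_cis_Arg:
  assumes "\<And>j. norm (z j) = 1"
  shows "(\<Prod>j\<in>A. z j) = cis (Arg (\<Prod>j\<in>A. z j))"
proof -
  have "norm (\<Prod>j\<in>A. z j) = 1" using assms by (simp add: prod_norm[symmetric])
  then show ?thesis by (metis cis_Arg norm_zero sgn_div_norm inverse_1 scaleR_one zero_neq_one)
qed

section \<open>Upper and lower bounds for the smallest spacing\<close>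

context
  fixes n :: nat and p :: "nat \<Rightarrow> nat" and z :: "nat \<Rightarrow> complex"
  assumes p: "p permutes {..<n}" and n: "0 < n" and z: "\<And>j. norm (z j) = 1"
begin

lemma min_spacing_phase_perm_matrix:
  defines "E \<equiv> eigenangles (phase_perm_matrix n p z)"
  shows "\<exists>s\<in>E. \<exists>t\<in>E. s < t \<and> min_spacing (phase_perm_matrix n p z) = t - s"
    and "\<And>s t. s \<in> E \<Longrightarrow> t \<in> E \<Longrightarrow> s < t \<Longrightarrow> min_spacing (phase_perm_matrix n p z) \<le> t - s"
proof -
  have E: "E = (\<Union>i<n. {t. cis (cycle_len p i * t) = (\<Prod>j\<in>orbit p i. z j)})"
    unfolding E_def eigenangles_phase_perm_matrix[OF p] by auto
  have "Arg (\<Prod>j\<in>orbit p 0. z j) / cycle_len p 0 \<in> E"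
    unfolding E
    using n prod_eq_cis_Arg[where z = z and A = "orbit p 0", OF z, symmetric] cycle_len_pos[OF p, of 0]
    by (intro UN_I[of 0]) simp_all
  then have 1: "E \<noteq> {}" by auto
  have 2: "t + 2 * pi * k \<in> E" if "t \<in> E" for t and k :: int
  proof -
    have "cis (real L * (t + 2 * pi * k)) = cis (real L * t)" for L
      unfolding cis_eq_cis_iff by (intro exI[of _ "int L * k"]) (simp add: algebra_simps)
    with that show ?thesis by (simp add: E)
  qed
  have 3: "finite (E \<inter> {a..b})" for a b
  proof -
    have "finite ({t. cis (cycle_len p i * t) = w} \<inter> {a..b})" for i w
      using cycle_len_pos[OF p] by (intro finite_cis_eq_Icc) simp
    then have "finite (\<Union>i<n. {t. cis (cycle_len p i * t) = (\<Prod>j\<in>orbit p i. z j)} \<inter> {a..b})"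
      by (intro finite_UN_I) auto
    moreover have "E \<inter> {a..b} = (\<Union>i<n. {t. cis (cycle_len p i * t) = (\<Prod>j\<in>orbit p i. z j)} \<inter> {a..b})"
      unfolding E by blast
    ultimately show ?thesis by simp
  qed
  note * = Min_gaps[OF 1 2 3]
  show "\<exists>s\<in>E. \<exists>t\<in>E. s < t \<and> min_spacing (phase_perm_matrix n p z) = t - s"
    using *(1) by (simp add: min_spacing_def spacings_def E_def)
  show "min_spacing (phase_perm_matrix n p z) \<le> t - s" if "s \<in> E" "t \<in> E" "s < t" for s t
    using *(2)[OF _ that] by (simp add: min_spacing_def spacings_def E_def)
qed

lemma min_spacing_pos: "0 < min_spacing (phase_perm_matrix n p z)"
  using min_spacing_phase_perm_matrix(1) by auto

text \<open>The two cycles have angles (\<alpha> + 2 pi k)/a and (\<beta> + 2 pi l)/b. By Bezout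
  their differences fill a whole coset of (2 pi / lcm a b) times the integers, and every coset meets
  the interval from 0, excluded, to 2 pi / lcm a b, included. The phases only shift the
  coset.\<close>

lemma min_spacing_le_lcm:
  assumes "i < n" "j < n"
  shows "min_spacing (phase_perm_matrix n p z) \<le> 2 * pi / lcm (cycle_len p i) (cycle_len p j)"
proof -
  define a where "a = cycle_len p i"
  define b where "b = cycle_len p j"
  define \<alpha> where "\<alpha> = Arg (\<Prod>j\<in>orbit p i. z j)"
  define \<beta> where "\<beta> = Arg (\<Prod>k\<in>orbit p j. z k)"
  let ?E = "eigenangles (phase_perm_matrix n p z)"
  have ab: "0 < a" "0 < b" using cycle_len_pos[OF p] by (auto simp: a_def b_def)
  then have l0: "0 < lcm a b" by (simp add: lcm_pos_nat)
  have s: "(\<alpha> + 2 * pi * k) / a \<in> ?E" for k :: int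
    unfolding eigenangles_phase_perm_matrix[OF p]
    using assms prod_eq_cis_Arg[where z = z and A = "orbit p i", OF z] ab(1)
    by (auto simp: a_def[symmetric] \<alpha>_def[symmetric] cis_eq_cis_iff intro!: exI[of _ i])
  have t: "(\<beta> + 2 * pi * k) / b \<in> ?E" for k :: int
    unfolding eigenangles_phase_perm_matrix[OF p]
    using assms prod_eq_cis_Arg[where z = z and A = "orbit p j", OF z] ab(2)
    by (auto simp: b_def[symmetric] \<beta>_def[symmetric] cis_eq_cis_iff intro!: exI[of _ j])
  obtain u v :: int where uv: "u * int a + v * int b = gcd (int a) (int b)"
    using bezout_int by blast
  define x where "x = \<beta> / b - \<alpha> / a"
  \<comment> \<open>Moves the rescaled difference into (0, 1]; openness at 0 is essential, since
    coinciding angles give no spacing.\<close>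
  define m where "m = 1 - \<lceil>x * lcm a b / (2 * pi)\<rceil>"
  have *: "0 < x * lcm a b / (2 * pi) + m" "x * lcm a b / (2 * pi) + m \<le> 1"
    unfolding m_def by linarith+
  have m: "0 < x + 2 * pi * m / lcm a b" "x + 2 * pi * m / lcm a b \<le> 2 * pi / lcm a b"
  proof -
    have eq: "x + 2 * pi * m / lcm a b = (x * lcm a b / (2 * pi) + m) * (2 * pi / lcm a b)"
    proof -
      have "x * lcm a b / (2 * pi) * (2 * pi / lcm a b) = x" using l0 ab by simp
      then show ?thesis by (simp only: distrib_right) simp
    qed
    show "0 < x + 2 * pi * m / lcm a b" unfolding eq using * l0 by (intro mult_pos_pos) auto
    show "x + 2 * pi * m / lcm a b \<le> 2 * pi / lcm a b"
      unfolding eq using mult_right_mono[OF *(2), of "2 * pi / lcm a b"] by simp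
  qed
  have "real (gcd a b) = real_of_int (gcd (int a) (int b))" by simp
  also have "\<dots> = u * a + v * b" unfolding uv[symmetric] by simp
  finally have g: "real (gcd a b) = u * a + v * b" .
  have "real (gcd a b) * real (lcm a b) = a * b"
    unfolding of_nat_mult[symmetric] prod_gcd_lcm_nat[of a b] ..
  \<comment> \<open>Bezout divided by a b: a step of 1 / lcm a b is split into u steps of 1/b and v
    steps of 1/a, so \<open>m * u\<close> and \<open>- m * v\<close> index the two angles.\<close>
  then have "1 / real (lcm a b) = (u * a + v * b) / (a * b)"
    using l0 ab g by (simp add: field_simps)
  also have "\<dots> = u / b + v / a" using ab by (simp add: field_simps)
  finally have "2 * pi * m * (1 / lcm a b) = 2 * pi * m * (u / b + v / a)" by simp
  then have "x + 2 * pi * m / lcm a b =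
      (\<beta> + 2 * pi * of_int (m * u)) / b - (\<alpha> + 2 * pi * of_int (- m * v)) / a"
    unfolding x_def using ab by (simp add: add_divide_distrib diff_divide_distrib distrib_left mult_ac)
  with m min_spacing_phase_perm_matrix(2)[OF s[of "- m * v"] t[of "m * u"]]
  show ?thesis by (simp add: a_def b_def)
qed

text \<open>If the angles s and t come from cycles of lengths a and b with phase products u and v,
  then cis (a s) = u and cis (b t) = v, so v^a times the conjugate of u^b equals cis (a b (t - s)).
  The choice of roots has disappeared.\<close>

lemma small_min_spacing_cycles:
  fixes \<delta> :: real
  assumes "min_spacing (phase_perm_matrix n p z) < \<delta>" "\<delta> \<le> 2 * pi / n ^ 2"
  obtains i j where "i < n" "j < n" "orbit p i \<noteq> orbit p j"
    and "(\<Prod>k\<in>orbit p j. z k) ^ cycle_len p i * cnj ((\<Prod>k\<in>orbit p i. z k) ^ cycle_len p j)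
      \<in> cis ` {0..cycle_len p i * cycle_len p j * \<delta>}"
proof -
  obtain s t where st: "s \<in> eigenangles (phase_perm_matrix n p z)"
      "t \<in> eigenangles (phase_perm_matrix n p z)" "s < t"
      "min_spacing (phase_perm_matrix n p z) = t - s"
    using min_spacing_phase_perm_matrix(1) by blast
  then obtain i j where i: "i < n" "cis (cycle_len p i * s) = (\<Prod>k\<in>orbit p i. z k)"
    and j: "j < n" "cis (cycle_len p j * t) = (\<Prod>k\<in>orbit p j. z k)"
    unfolding eigenangles_phase_perm_matrix[OF p] by blast
  define a where "a = cycle_len p i"
  define b where "b = cycle_len p j"
  have ab: "0 < a" "0 < b" "a \<le> n" "b \<le> n"
    using cycle_len_pos[OF p] cycle_len_le[OF p] i j by (auto simp: a_def b_def)
  \<comment> \<open>Distinct angles of one cycle differ by at least 2 pi / a \<ge> 2 pi / n^2, which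
    the bound on \<delta> excludes.\<close>
  have "orbit p i \<noteq> orbit p j"
  proof
    assume "orbit p i = orbit p j"
    then have "cis (a * t) = cis (a * s)" using i j by (simp add: a_def)
    then obtain k :: int where "a * t = a * s + 2 * pi * k" unfolding cis_eq_cis_iff by blast
    then have k: "a * (t - s) = 2 * pi * k" by (simp add: algebra_simps)
    moreover have "0 < a * (t - s)" using ab st by simp
    ultimately have "0 < k" by (simp add: zero_less_mult_iff)
    then have "2 * pi * 1 \<le> 2 * pi * real_of_int k" by (intro mult_left_mono) auto
    then have "2 * pi \<le> a * (t - s)" using k by simp
    also have "\<dots> \<le> n ^ 2 * (t - s)"
    proof (rule mult_right_mono)
      have "a * 1 \<le> n * n" using ab n by (intro mult_mono) auto
      then show "real a \<le> real (n ^ 2)" unfolding power2_eq_square by (subst of_nat_le_iff) simp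
    qed (use st in simp)
    also have "\<dots> < n ^ 2 * \<delta>" using st assms n by (intro mult_strict_left_mono) auto
    also have "\<dots> \<le> n ^ 2 * (2 * pi / n ^ 2)" using assms by (intro mult_left_mono) auto
    also have "\<dots> = 2 * pi" using n by simp
    finally show False by simp
  qed
  moreover have "(\<Prod>k\<in>orbit p j. z k) ^ a * cnj ((\<Prod>k\<in>orbit p i. z k) ^ b) = cis (a * b * (t - s))"
    unfolding i(2)[symmetric] j(2)[symmetric]
    by (simp add: Complex.DeMoivre cis_cnj cis_mult a_def b_def algebra_simps)
  moreover have "a * b * (t - s) \<in> {0..a * b * \<delta>}"
    using st assms ab by (auto intro!: mult_left_mono)
  ultimately show thesis using i j that unfolding a_def b_def by auto
qed

end

text \<open>Without phases a s and b t are multiples of 2 pi, so a b (t - s) is a positive multiple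
  of 2 pi, while a b \<le> n^2.\<close>

lemma min_spacing_perm_matrix_ge:
  assumes p: "p permutes {..<n}" and n: "0 < n"
  shows "2 * pi / n ^ 2 \<le> min_spacing (perm_matrix n p)"
proof -
  obtain s t where st: "s \<in> eigenangles (perm_matrix n p)"
      "t \<in> eigenangles (perm_matrix n p)" "s < t" "min_spacing (perm_matrix n p) = t - s"
    using min_spacing_phase_perm_matrix(1)[OF p n, of "\<lambda>_. 1"] unfolding perm_matrix_eq_phase by auto
  then obtain i j where i: "i < n" "cis (cycle_len p i * s) = 1"
    and j: "j < n" "cis (cycle_len p j * t) = 1"
    unfolding perm_matrix_eq_phase eigenangles_phase_perm_matrix[OF p] by auto
  define a where "a = cycle_len p i"
  define b where "b = cycle_len p j"
  have ab: "0 < a" "0 < b" "a \<le> n" "b \<le> n"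
    using cycle_len_pos[OF p] cycle_len_le[OF p] i j
    by (auto simp: a_def b_def)
  have "cis (a * s) ^ b = cis 0" "cis (b * t) ^ a = cis 0" using i j by (simp_all add: a_def b_def)
  then have "cis (a * b * t) = cis (a * b * s)" unfolding Complex.DeMoivre by (simp add: mult_ac)
  then obtain k :: int where "a * b * t = a * b * s + 2 * pi * k" unfolding cis_eq_cis_iff by blast
  then have k: "a * b * (t - s) = 2 * pi * k" by (simp add: algebra_simps)
  moreover have "0 < a * b * (t - s)" using ab st by simp
  ultimately have "0 < k" by (simp add: zero_less_mult_iff)
  then have "2 * pi * 1 \<le> 2 * pi * real_of_int k" by (intro mult_left_mono) auto
  then have "2 * pi \<le> a * b * (t - s)" using k by simp
  also have "\<dots> \<le> n ^ 2 * (t - s)"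
  proof (rule mult_right_mono)
    have "a * b \<le> n * n" using ab by (intro mult_mono) auto
    then show "real (a * b) \<le> real (n ^ 2)"
      unfolding power2_eq_square by (rule of_nat_mono)
  qed (use st in simp)
  finally show ?thesis using n unfolding st(4) by (simp add: field_simps)
qed

section \<open>Random phases\<close>

lemma int_Icc_real: "{k :: int. a \<le> real_of_int k \<and> real_of_int k \<le> b} = {\<lceil>a\<rceil>..\<lfloor>b\<rfloor>}"
  by (auto simp: ceiling_le_iff le_floor_iff)

text \<open>The set is covered by intervals of length \<rho> / m, one for each integer k with m t +
  \<phi> in [2 pi k, 2 pi k + \<rho>]. At most m + 2 \<le> 3 m integers k can occur, which is crude
  but sufficient.\<close>

lemma emeasure_power_arc_le:
  assumes m: "0 < (m :: nat)" and \<rho>: "0 \<le> \<rho>" "\<rho> \<le> 2 * pi"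
  shows "emeasure lborel ({0..2 * pi} \<inter> {t. cis (m * t + \<phi>) \<in> cis ` {0..\<rho>}}) \<le> ennreal (3 * \<rho>)"
proof -
  define I where "I = {\<lceil>(\<phi> - \<rho>) / (2 * pi)\<rceil>..\<lfloor>\<phi> / (2 * pi) + m\<rfloor>}"
  define A where "A k = {(2 * pi * real_of_int k - \<phi>) / m .. (2 * pi * real_of_int k - \<phi> + \<rho>) / m}" for k
  have sub: "{0..2 * pi} \<inter> {t. cis (m * t + \<phi>) \<in> cis ` {0..\<rho>}} \<subseteq> (\<Union>k\<in>I. A k)"
  proof
    fix t assume t: "t \<in> {0..2 * pi} \<inter> {t. cis (m * t + \<phi>) \<in> cis ` {0..\<rho>}}"
    then obtain x where x: "0 \<le> x" "x \<le> \<rho>" "cis (m * t + \<phi>) = cis x" by auto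
    then obtain k :: int where k: "m * t + \<phi> = x + 2 * pi * k" unfolding cis_eq_cis_iff by blast
    have mt: "0 \<le> m * t" "m * t \<le> m * (2 * pi)" using t by (auto intro: mult_left_mono)
    have "(\<phi> - \<rho>) \<le> real_of_int k * (2 * pi)" using mt x k by (simp add: mult_ac)
    then have "(\<phi> - \<rho>) / (2 * pi) \<le> real_of_int k" by (subst pos_divide_le_eq) auto
    moreover have "real_of_int k * (2 * pi) \<le> \<phi> + m * (2 * pi)" using mt x k by (simp add: mult_ac)
    then have "real_of_int k \<le> (\<phi> + m * (2 * pi)) / (2 * pi)" by (subst pos_le_divide_eq) auto
    then have "real_of_int k \<le> \<phi> / (2 * pi) + m" by (simp add: add_divide_distrib)
    ultimately have "k \<in> I" unfolding I_def int_Icc_real[symmetric] by simp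
    moreover have "t = (2 * pi * real_of_int k - \<phi> + x) / m" using k m by (simp add: field_simps)
    then have "t \<in> A k" unfolding A_def using x m by (auto intro!: divide_right_mono)
    ultimately show "t \<in> (\<Union>k\<in>I. A k)" by blast
  qed
  have "real (card I) \<le> 3 * m"
  proof -
    have "real_of_int (\<lfloor>\<phi> / (2 * pi) + m\<rfloor> - \<lceil>(\<phi> - \<rho>) / (2 * pi)\<rceil> + 1)
        \<le> \<phi> / (2 * pi) + m - (\<phi> - \<rho>) / (2 * pi) + 1"
      by linarith
    also have "\<dots> = m + \<rho> / (2 * pi) + 1" by (simp add: diff_divide_distrib)
    also have "\<rho> / (2 * pi) \<le> 1" using \<rho> by (subst pos_divide_le_eq) auto
    finally have "real_of_int (\<lfloor>\<phi> / (2 * pi) + m\<rfloor> - \<lceil>(\<phi> - \<rho>) / (2 * pi)\<rceil> + 1) \<le> 3 * m"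
      using m by simp
    then show ?thesis unfolding I_def card_atLeastAtMost_int by simp
  qed
  have "emeasure lborel ({0..2 * pi} \<inter> {t. cis (m * t + \<phi>) \<in> cis ` {0..\<rho>}}) \<le> emeasure lborel (\<Union>k\<in>I. A k)"
    by (rule emeasure_mono[OF sub]) (auto simp: A_def I_def)
  also have "\<dots> \<le> (\<Sum>k\<in>I. emeasure lborel (A k))"
    by (rule emeasure_subadditive_finite) (auto simp: A_def I_def)
  also have "\<dots> = (\<Sum>k\<in>I. ennreal (\<rho> / m))"
  proof (rule sum.cong[OF refl])
    fix k
    have "(2 * pi * real_of_int k - \<phi>) / m \<le> (2 * pi * real_of_int k - \<phi> + \<rho>) / m"
      using \<rho> by (intro divide_right_mono) auto
    moreover have "(2 * pi * real_of_int k - \<phi> + \<rho>) / m - (2 * pi * real_of_int k - \<phi>) / m = \<rho> / m"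
      unfolding diff_divide_distrib[symmetric] by simp
    ultimately show "emeasure lborel (A k) = ennreal (\<rho> / m)"
      unfolding A_def by simp
  qed
  also have "\<dots> = ennreal (card I * (\<rho> / m))"
    using \<rho> by (simp add: ennreal_of_nat_eq_real_of_nat flip: ennreal_mult)
  also have "\<dots> \<le> ennreal (3 * m * (\<rho> / m))"
    using \<rho> \<open>real (card I) \<le> 3 * m\<close> by (intro ennreal_leI mult_right_mono) auto
  also have "\<dots> = ennreal (3 * \<rho>)" using m by simp
  finally show ?thesis .
qed

abbreviation circle_arc :: "real \<Rightarrow> complex set" where
  "circle_arc \<rho> \<equiv> cis ` {0..\<rho>}"

lemma circle_arc_borel [measurable]: "circle_arc \<rho> \<in> sets borel"
proof -
  have "compact (circle_arc \<rho>)"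
    by (intro compact_continuous_image continuous_intros compact_Icc)
  then show ?thesis by (intro borel_closed compact_imp_closed)
qed

lemma cnj_measurable [measurable]: "cnj \<in> borel_measurable borel"
  by (intro borel_measurable_continuous_onI continuous_intros)

lemma space_circle: "space circle_space = sphere 0 1"
  by (simp add: space_restrict_space)

lemma measurable_circle_iff:
  "f \<in> M \<rightarrow>\<^sub>M circle_space \<longleftrightarrow> f \<in> borel_measurable M \<and> (\<forall>x\<in>space M. norm (f x) = 1)"
  by (auto simp: measurable_restrict_space2_iff)

lemma id_circle_measurable: "(\<lambda>x. x) \<in> borel_measurable circle_space"
  by (rule measurable_restrict_space1) simp

lemma cis_measurable_circle: "cis \<in> borel \<rightarrow>\<^sub>M circle_space"
  unfolding measurable_circle_iff by (auto intro!: borel_measurable_continuous_onI continuous_intros)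

lemma prob_space_uniform_circle: "prob_space uniform_circle"
proof -
  have "prob_space (uniform_measure lborel {0..2 * pi})"
    by (intro prob_space_uniform_measure) auto
  then show ?thesis
    unfolding uniform_circle_def
    by (rule prob_space.prob_space_distr) (use cis_measurable_circle in \<open>simp cong: measurable_cong_sets\<close>)
qed

text \<open>The factor 3 of the covering is absorbed by the normalisation, as 3 \<le> 2 pi. For
  \<rho> > 1 the total mass 1 is already a bound.\<close>

lemma uniform_circle_power_arc_le:
  assumes m: "0 < (m :: nat)" and w: "norm w = 1" and \<rho>: "0 \<le> \<rho>"
  shows "emeasure uniform_circle {x \<in> sphere 0 1. x ^ m * w \<in> circle_arc \<rho>} \<le> ennreal \<rho>"
proof (cases "\<rho> \<le> 1")
  case True
  have "(\<lambda>x. x ^ m * w) \<in> borel_measurable circle_space"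
    using id_circle_measurable by measurable
  from measurable_sets[OF this circle_arc_borel]
  have A: "{x \<in> sphere 0 1. x ^ m * w \<in> circle_arc \<rho>} \<in> sets circle_space"
    by (simp add: vimage_def space_circle Int_def conj_commute)
  obtain \<phi> where \<phi>: "w = cis \<phi>"
    using w by (metis cis_Arg norm_zero sgn_div_norm inverse_1 scaleR_one zero_neq_one)
  have cm: "cis \<in> uniform_measure lborel {0..2 * pi} \<rightarrow>\<^sub>M circle_space"
    using cis_measurable_circle by (simp cong: measurable_cong_sets)
  let ?B = "{t :: real. cis (m * t + \<phi>) \<in> circle_arc \<rho>}"
  have eq: "cis -` {x \<in> sphere 0 1. x ^ m * w \<in> circle_arc \<rho>} \<inter> space (uniform_measure lborel {0..2 * pi}) = ?B"
    by (auto simp: \<phi> Complex.DeMoivre cis_mult)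
  have B: "?B \<in> sets lborel"
    using measurable_sets[OF cm A] unfolding eq by simp
  have "emeasure uniform_circle {x \<in> sphere 0 1. x ^ m * w \<in> circle_arc \<rho>}
      = emeasure (uniform_measure lborel {0..2 * pi}) ?B"
    unfolding uniform_circle_def emeasure_distr[OF cm A] eq ..
  also have "\<dots> = emeasure lborel ({0..2 * pi} \<inter> ?B) / emeasure lborel {0..2 * pi}"
    using B by (intro emeasure_uniform_measure) auto
  also have "\<dots> \<le> ennreal (3 * \<rho>) / emeasure lborel {0..2 * pi}"
    using True \<rho> m pi_ge_two by (intro divide_right_mono_ennreal emeasure_power_arc_le) auto
  also have "\<dots> = ennreal (3 * \<rho> / (2 * pi))"
    using \<rho> by (simp add: divide_ennreal)
  also have "\<dots> \<le> ennreal \<rho>"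
  proof (rule ennreal_leI)
    have "3 * \<rho> \<le> \<rho> * (2 * pi)" using \<rho> pi_ge_two mult_left_mono[of 3 "2 * pi" \<rho>] by (simp add: mult_ac)
    then show "3 * \<rho> / (2 * pi) \<le> \<rho>" by (subst pos_divide_le_eq) auto
  qed
  finally show ?thesis .
next
  case False
  interpret prob_space uniform_circle by (rule prob_space_uniform_circle)
  have "emeasure uniform_circle {x \<in> sphere 0 1. x ^ m * w \<in> circle_arc \<rho>} \<le> ennreal 1"
    by (simp add: emeasure_le_1)
  also have "\<dots> \<le> ennreal \<rho>" using False by (intro ennreal_leI) simp
  finally show ?thesis .
qed

section \<open>Independent phases of two disjoint cycles\<close>

context prob_space
begin

text \<open>One phase \<open>z j\<close> with j in \<open>B\<close> already provides enough
  randomness: given all other phases the expression is \<open>z j\<close> to the power a times a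
  unimodular constant, so the one-variable bound applies and is integrated out.\<close>

lemma prob_cycle_pair_arc_le:
  fixes z :: "nat \<Rightarrow> 'a \<Rightarrow> complex"
  assumes ind: "indep_vars (\<lambda>_. circle_space) z UNIV"
    and unif: "\<And>j. distr M circle_space (z j) = uniform_circle"
    and fin: "finite A" "finite B" and disj: "A \<inter> B = {}" and ne: "B \<noteq> {}"
    and a: "0 < a" and \<rho>: "0 \<le> \<rho>"
  shows "prob {\<omega> \<in> space M. (\<Prod>k\<in>B. z k \<omega>) ^ a * cnj ((\<Prod>k\<in>A. z k \<omega>) ^ b) \<in> circle_arc \<rho>} \<le> \<rho>"
proof -
  obtain j where j: "j \<in> B" using ne by auto
  define J where "J = A \<union> B - {j}"
  \<comment> \<open>The factor formed by the other phases. As \<open>A\<close> and \<open>B\<close>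
    are disjoint, it does not involve \<open>z j\<close> and is therefore independent of it.\<close>
  define W where "W f = (\<Prod>k\<in>B - {j}. f k) ^ a * cnj ((\<Prod>k\<in>A. f k) ^ b)" for f :: "nat \<Rightarrow> complex"
  have z: "z k \<in> M \<rightarrow>\<^sub>M circle_space" for k
    using ind by (auto simp: indep_vars_def)
  have comp: "(\<lambda>f. f k) \<in> borel_measurable (Pi\<^sub>M J (\<lambda>_. circle_space))" if "k \<in> J" for k
    using measurable_compose[OF measurable_component_singleton[OF that] id_circle_measurable] .
  have Wm: "W \<in> Pi\<^sub>M J (\<lambda>_. circle_space) \<rightarrow>\<^sub>M circle_space"
    unfolding measurable_circle_iff
  proof (intro conjI ballI)
    have "(\<lambda>f. \<Prod>k\<in>B - {j}. f k) \<in> borel_measurable (Pi\<^sub>M J (\<lambda>_. circle_space))"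
      "(\<lambda>f. \<Prod>k\<in>A. f k) \<in> borel_measurable (Pi\<^sub>M J (\<lambda>_. circle_space))"
      by (intro borel_measurable_prod comp; use disj j in \<open>auto simp: J_def\<close>)+
    then show "W \<in> borel_measurable (Pi\<^sub>M J (\<lambda>_. circle_space))"
      unfolding W_def by measurable
    fix f assume "f \<in> space (Pi\<^sub>M J (\<lambda>_. circle_space))"
    then have f: "norm (f k) = 1" if "k \<in> J" for k
      using that by (auto simp: space_PiM space_circle)
    have "norm (\<Prod>k\<in>B - {j}. f k) = 1" "norm (\<Prod>k\<in>A. f k) = 1"
      using f disj j by (auto simp: prod_norm[symmetric] J_def intro!: prod.neutral)
    then show "norm (W f) = 1"
      unfolding W_def norm_mult norm_power complex_mod_cnj by simp
  qed
  have "indep_var (Pi\<^sub>M J (\<lambda>_. circle_space)) (\<lambda>\<omega>. restrict (\<lambda>k. z k \<omega>) J)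
          (Pi\<^sub>M {j} (\<lambda>_. circle_space)) (\<lambda>\<omega>. restrict (\<lambda>k. z k \<omega>) {j})"
    by (rule indep_var_restrict[OF ind]) (auto simp: J_def)
  from indep_var_compose[OF this Wm measurable_component_singleton[of j "{j}"]]
  have "indep_var circle_space (W \<circ> (\<lambda>\<omega>. restrict (\<lambda>k. z k \<omega>) J)) circle_space
      ((\<lambda>f. f j) \<circ> (\<lambda>\<omega>. restrict (\<lambda>k. z k \<omega>) {j}))" by simp
  moreover have "W \<circ> (\<lambda>\<omega>. restrict (\<lambda>k. z k \<omega>) J) = (\<lambda>\<omega>. W (\<lambda>k. z k \<omega>))"
  proof
    fix \<omega>
    have J: "B - {j} \<subseteq> J" "A \<subseteq> J" using disj j by (auto simp: J_def)
    have "(\<Prod>k\<in>B - {j}. restrict (\<lambda>k. z k \<omega>) J k) = (\<Prod>k\<in>B - {j}. z k \<omega>)"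
      "(\<Prod>k\<in>A. restrict (\<lambda>k. z k \<omega>) J k) = (\<Prod>k\<in>A. z k \<omega>)"
      using J by (auto intro!: prod.cong)
    then show "(W \<circ> (\<lambda>\<omega>. restrict (\<lambda>k. z k \<omega>) J)) \<omega> = W (\<lambda>k. z k \<omega>)"
      by (simp only: W_def o_apply)
  qed
  moreover have "(\<lambda>f. f j) \<circ> (\<lambda>\<omega>. restrict (\<lambda>k. z k \<omega>) {j}) = z j" by (auto simp: fun_eq_iff)
  ultimately have "indep_var circle_space (\<lambda>\<omega>. W (\<lambda>k. z k \<omega>)) circle_space (z j)"
    by simp
  then have Wr: "(\<lambda>\<omega>. W (\<lambda>k. z k \<omega>)) \<in> M \<rightarrow>\<^sub>M circle_space"
    and joint: "distr M circle_space (\<lambda>\<omega>. W (\<lambda>k. z k \<omega>)) \<Otimes>\<^sub>M distr M circle_space (z j)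
      = distr M (circle_space \<Otimes>\<^sub>M circle_space) (\<lambda>\<omega>. (W (\<lambda>k. z k \<omega>), z j \<omega>))"
    unfolding indep_var_distribution_eq by auto
  let ?N = "distr M circle_space (\<lambda>\<omega>. W (\<lambda>k. z k \<omega>))"
  let ?S = "{(w, x). w \<in> sphere 0 1 \<and> x \<in> sphere 0 1 \<and> x ^ a * w \<in> circle_arc \<rho>}"
  have "(\<lambda>(w, x). x ^ a * w) \<in> borel_measurable (circle_space \<Otimes>\<^sub>M circle_space)"
    using measurable_compose[OF measurable_fst id_circle_measurable]
      measurable_compose[OF measurable_snd id_circle_measurable]
    unfolding case_prod_unfold by measurable
  from measurable_sets[OF this circle_arc_borel]
  have S: "?S \<in> sets (circle_space \<Otimes>\<^sub>M circle_space)"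
    by (rule back_subst[of "\<lambda>A. A \<in> sets _"]) (auto simp: space_pair_measure space_circle)
  interpret U: prob_space uniform_circle by (rule prob_space_uniform_circle)
  interpret N: prob_space ?N by (rule prob_space_distr[OF Wr])
  have "{\<omega> \<in> space M. (\<Prod>k\<in>B. z k \<omega>) ^ a * cnj ((\<Prod>k\<in>A. z k \<omega>) ^ b) \<in> circle_arc \<rho>}
      = (\<lambda>\<omega>. (W (\<lambda>k. z k \<omega>), z j \<omega>)) -` ?S \<inter> space M"
  proof -
    have "(\<Prod>k\<in>B. z k \<omega>) ^ a * cnj ((\<Prod>k\<in>A. z k \<omega>) ^ b) = z j \<omega> ^ a * W (\<lambda>k. z k \<omega>)" for \<omega>
      using prod.remove[OF fin(2) j, of "\<lambda>k. z k \<omega>"] by (simp add: W_def power_mult_distrib mult_ac)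
    then show ?thesis
      using z[of j] Wr unfolding measurable_circle_iff by auto
  qed
  then have "emeasure M {\<omega> \<in> space M. (\<Prod>k\<in>B. z k \<omega>) ^ a * cnj ((\<Prod>k\<in>A. z k \<omega>) ^ b) \<in> circle_arc \<rho>}
      = emeasure (distr M (circle_space \<Otimes>\<^sub>M circle_space) (\<lambda>\<omega>. (W (\<lambda>k. z k \<omega>), z j \<omega>))) ?S"
    using z[of j] Wr S by (subst emeasure_distr) (auto intro!: measurable_Pair)
  also have "\<dots> = emeasure (?N \<Otimes>\<^sub>M uniform_circle) ?S"
    unfolding joint[symmetric] unif ..
  \<comment> \<open>Independence has turned the joint law into a product, so the probability is
    computed by fixing the value w of \<open>W\<close> first.\<close>
  also have "\<dots> = (\<integral>\<^sup>+w. emeasure uniform_circle (Pair w -` ?S) \<partial>?N)"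
  proof (rule U.emeasure_pair_measure_alt)
    have "sets (?N \<Otimes>\<^sub>M uniform_circle) = sets (circle_space \<Otimes>\<^sub>M circle_space)"
      by (intro sets_pair_measure_cong) (auto simp: uniform_circle_def)
    with S show "?S \<in> sets (?N \<Otimes>\<^sub>M uniform_circle)" by simp
  qed
  also have "\<dots> \<le> (\<integral>\<^sup>+w. ennreal \<rho> \<partial>?N)"
  proof (rule nn_integral_mono)
    fix w assume "w \<in> space ?N"
    then have w: "norm w = 1" by (simp add: space_circle)
    have "Pair w -` ?S = {x \<in> sphere 0 1. x ^ a * w \<in> circle_arc \<rho>}" using w by auto
    then show "emeasure uniform_circle (Pair w -` ?S) \<le> ennreal \<rho>"
      using uniform_circle_power_arc_le[OF a w \<rho>] by simp
  qed
  also have "\<dots> = ennreal \<rho>" using N.emeasure_space_1 by simp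
  finally show ?thesis using \<rho> by (simp add: emeasure_eq_measure)
qed

end

section \<open>Union bound over pairs of cycles\<close>

lemma sum_card_orbits:
  assumes "p permutes {..<n}"
  shows "(\<Sum>A\<in>orbit p ` {..<n}. card A) = n"
proof -
  have cyc: "cyclic_on p (orbit p i)" for i
    using assms by (intro cyclic_on_orbit) auto
  have self: "i \<in> orbit p i" for i
    using assms permutation_permutes permutation_self_in_orbit finite_lessThan by metis
  have disj: "orbit p i \<inter> orbit p j = {}" if "orbit p i \<noteq> orbit p j" for i j
    using that orbit_cyclic_eq3[OF cyc] by (metis disjoint_iff)
  have sub: "orbit p i \<subseteq> {..<n}" if "i < n" for i
    using permutes_orbit_subset[OF assms] that by simp
  have "(\<Sum>A\<in>orbit p ` {..<n}. card A) = card (\<Union> (orbit p ` {..<n}))"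
    by (rule card_Union_disjoint[symmetric])
       (auto simp: pairwise_def disjnt_def disj intro: finite_subset[OF sub])
  also have "\<Union> (orbit p ` {..<n}) = {..<n}"
    using self sub by blast
  finally show ?thesis by simp
qed

text \<open>
  A spacing smaller than \<open>\<delta>\<close> between an angle of the cycle \<open>A\<close> and one of another cycle \<open>B\<close> implies this
  condition, which constrains the phases without reference to the choice of roots.
\<close>

definition close_cycles :: "nat \<Rightarrow> (nat \<Rightarrow> nat) \<Rightarrow> real \<Rightarrow> (nat \<Rightarrow> complex) \<Rightarrow> bool" where
  "close_cycles n p \<delta> z \<longleftrightarrow> (\<exists>A\<in>orbit p ` {..<n}. \<exists>B\<in>orbit p ` {..<n}. A \<noteq> B \<and>
     (\<Prod>k\<in>B. z k) ^ card A * cnj ((\<Prod>k\<in>A. z k) ^ card B) \<in> circle_arc (real (card A * card B) * \<delta>))"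

lemma close_cycles_measurable:
  assumes "\<And>j. (\<lambda>x. f x j) \<in> borel_measurable N"
  shows "{x \<in> space N. close_cycles n p \<delta> (f x)} \<in> sets N"
proof -
  have [measurable]: "(\<lambda>x. \<Prod>k\<in>A. f x k) \<in> borel_measurable N" for A
    using assms by (intro borel_measurable_prod)
  have "{x \<in> space N. (\<Prod>k\<in>B. f x k) ^ card A * cnj ((\<Prod>k\<in>A. f x k) ^ card B) \<in> circle_arc (real (card A * card B) * \<delta>)} \<in> sets N" for A B
    by measurable
  then have "{x \<in> space N. A \<noteq> B \<and> (\<Prod>k\<in>B. f x k) ^ card A * cnj ((\<Prod>k\<in>A. f x k) ^ card B) \<in> circle_arc (real (card A * card B) * \<delta>)} \<in> sets N" for A B
    by (cases "A = B") auto
  then show ?thesis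
    unfolding close_cycles_def by (intro sets.sets_Collect_finite_Ex) auto
qed

context prob_space
begin

text \<open>The bounds \<open>card A * card B * \<delta>\<close> add up to \<delta> times the square
  of the sum of all cycle lengths, which is n. The result is uniform in the permutation.\<close>

lemma prob_close_cycles_le:
  fixes z :: "nat \<Rightarrow> 'a \<Rightarrow> complex"
  assumes ind: "indep_vars (\<lambda>_. circle_space) z UNIV"
    and unif: "\<And>j. distr M circle_space (z j) = uniform_circle"
    and p: "p permutes {..<n}" and \<delta>: "0 \<le> \<delta>"
  shows "prob {\<omega> \<in> space M. close_cycles n p \<delta> (\<lambda>j. z j \<omega>)} \<le> real n ^ 2 * \<delta>"
proof -
  let ?O = "orbit p ` {..<n}"
  define Q where "Q A B = {\<omega> \<in> space M. A \<noteq> B \<and>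
     (\<Prod>k\<in>B. z k \<omega>) ^ card A * cnj ((\<Prod>k\<in>A. z k \<omega>) ^ card B) \<in> circle_arc (real (card A * card B) * \<delta>)}" for A B
  have zm: "z k \<in> borel_measurable M" for k
    using ind unfolding indep_vars_def measurable_circle_iff by auto
  have cyc: "cyclic_on p (orbit p i)" for i
    using p by (intro cyclic_on_orbit) auto
  have Qm: "Q A B \<in> events" for A B
  proof (cases "A = B")
    case False
    have [measurable]: "(\<lambda>x. \<Prod>k\<in>A. z k x) \<in> borel_measurable M" for A
      using zm by (intro borel_measurable_prod)
    have "{\<omega> \<in> space M. (\<Prod>k\<in>B. z k \<omega>) ^ card A * cnj ((\<Prod>k\<in>A. z k \<omega>) ^ card B) \<in> circle_arc (real (card A * card B) * \<delta>)} \<in> events"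
      by measurable
    then show ?thesis using False by (simp add: Q_def)
  qed (simp add: Q_def)
  have Q: "prob (Q A B) \<le> real (card A * card B) * \<delta>" if AB: "A \<in> ?O" "B \<in> ?O" for A B
  proof (cases "A = B")
    case False
    from AB obtain i j where ij: "i < n" "j < n" "A = orbit p i" "B = orbit p j" by auto
    have "finite A" "finite B"
      using ij finite_cyclic_on[OF cyc] by auto
    moreover have "A \<inter> B = {}"
      using False ij orbit_cyclic_eq3[OF cyc] by (metis disjoint_iff)
    moreover have "B \<noteq> {}" "A \<noteq> {}" using ij orbit_nonempty[of p i] orbit_nonempty[of p j] by auto
    ultimately show ?thesis
      using prob_cycle_pair_arc_le[OF ind unif, of A B "card A" "real (card A * card B) * \<delta>" "card B"] False \<delta>
      by (simp add: Q_def card_gt_0_iff)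
  qed (use \<delta> in \<open>simp add: Q_def\<close>)
  have "{\<omega> \<in> space M. close_cycles n p \<delta> (\<lambda>j. z j \<omega>)} = (\<Union>A\<in>?O. \<Union>B\<in>?O. Q A B)"
    unfolding close_cycles_def Q_def by blast
  also have "prob \<dots> \<le> (\<Sum>A\<in>?O. prob (\<Union>B\<in>?O. Q A B))"
    using Qm by (intro finite_measure_subadditive_finite) (auto intro!: sets.finite_UN)
  also have "\<dots> \<le> (\<Sum>A\<in>?O. \<Sum>B\<in>?O. prob (Q A B))"
    using Qm by (intro sum_mono finite_measure_subadditive_finite) auto
  also have "\<dots> \<le> (\<Sum>A\<in>?O. \<Sum>B\<in>?O. real (card A * card B) * \<delta>)"
    using Q by (intro sum_mono) auto
  also have "\<dots> = real (\<Sum>A\<in>?O. card A) * real (\<Sum>B\<in>?O. card B) * \<delta>"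
    unfolding of_nat_sum sum_product by (simp add: sum_distrib_right)
  also have "\<dots> = real n ^ 2 * \<delta>"
    unfolding sum_card_orbits[OF p] by (simp add: power2_eq_square)
  finally show ?thesis by simp
qed

text \<open>Decomposition over the value p of the random permutation: by independence each piece
  factorises, and averaging keeps the bound because it is uniform in p.\<close>

lemma prob_close_cycles_random_perm_le:
  fixes z :: "nat \<Rightarrow> 'a \<Rightarrow> complex" and \<sigma> :: "nat \<Rightarrow> 'a \<Rightarrow> nat \<Rightarrow> nat"
  assumes \<sigma>: "\<And>n. n \<ge> 1 \<Longrightarrow> \<sigma> n \<in> M \<rightarrow>\<^sub>M sym_space n"
    and ind: "indep_vars (\<lambda>_. circle_space) z UNIV"
    and unif: "\<And>j. distr M circle_space (z j) = uniform_circle"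
    and indep: "indep_set
           (sets (vimage_algebra (space M) (\<lambda>\<omega>. \<lambda>n\<in>{1..}. \<sigma> n \<omega>) (Pi\<^sub>M {1..} sym_space)))
           (sets (vimage_algebra (space M) (\<lambda>\<omega> j. z j \<omega>) (Pi\<^sub>M UNIV (\<lambda>_. circle_space))))"
    and n: "1 \<le> n" and \<delta>: "0 \<le> \<delta>"
  shows "prob {\<omega> \<in> space M. close_cycles n (\<sigma> n \<omega>) \<delta> (\<lambda>j. z j \<omega>)} \<le> real n ^ 2 * \<delta>"
    and "{\<omega> \<in> space M. close_cycles n (\<sigma> n \<omega>) \<delta> (\<lambda>j. z j \<omega>)} \<in> events"
proof -
  let ?P = "{p. p permutes {..<n}}"
  have fin: "finite ?P" by (simp add: finite_permutations)
  define S where "S p = {\<omega> \<in> space M. \<sigma> n \<omega> = p}" for p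
  define C where "C p = {\<omega> \<in> space M. close_cycles n p \<delta> (\<lambda>j. z j \<omega>)}" for p
  have zm: "z k \<in> M \<rightarrow>\<^sub>M circle_space" for k
    using ind unfolding indep_vars_def by auto
  have \<sigma>P: "\<sigma> m \<omega> permutes {..<m}" if "\<omega> \<in> space M" "1 \<le> m" for m \<omega>
    using measurable_space[OF \<sigma>[OF that(2)] that(1)] by simp
  \<comment> \<open>Independence is given between generated sigma-algebras, so \<open>S p\<close>,
    and likewise \<open>C p\<close>, is exhibited as a preimage under the generating map.\<close>
  have S: "S p \<in> sets (vimage_algebra (space M) (\<lambda>\<omega>. \<lambda>n\<in>{1..}. \<sigma> n \<omega>) (Pi\<^sub>M {1..} sym_space))" (is "_ \<in> ?X")
    if "p \<in> ?P" for p
  proof -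
    let ?D = "(\<lambda>f. f n) -` {p} \<inter> space (Pi\<^sub>M {1..} sym_space)"
    have "(\<lambda>f. f n) \<in> Pi\<^sub>M {1..} sym_space \<rightarrow>\<^sub>M sym_space n"
      using n by (intro measurable_component_singleton) simp
    then have "?D \<in> sets (Pi\<^sub>M {1..} sym_space)"
      using that by (intro measurable_sets) auto
    from in_vimage_algebra[OF this] have "(\<lambda>\<omega>. \<lambda>n\<in>{1..}. \<sigma> n \<omega>) -` ?D \<inter> space M \<in> ?X" .
    moreover have "(\<lambda>\<omega>. \<lambda>n\<in>{1..}. \<sigma> n \<omega>) -` ?D \<inter> space M = S p"
      using n \<sigma>P by (auto simp: S_def space_PiM)
    ultimately show ?thesis by simp
  qed
  have C: "C p \<in> sets (vimage_algebra (space M) (\<lambda>\<omega> j. z j \<omega>) (Pi\<^sub>M UNIV (\<lambda>_. circle_space)))" (is "_ \<in> ?X") for p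
  proof -
    let ?D = "{f \<in> space (Pi\<^sub>M UNIV (\<lambda>_. circle_space)). close_cycles n p \<delta> f}"
    have "(\<lambda>f. f k) \<in> borel_measurable (Pi\<^sub>M UNIV (\<lambda>_ :: nat. circle_space))" for k
      using measurable_compose[OF measurable_component_singleton[of k UNIV "\<lambda>_. circle_space"] id_circle_measurable]
      by simp
    then have "?D \<in> sets (Pi\<^sub>M UNIV (\<lambda>_. circle_space))"
      by (rule close_cycles_measurable)
    from in_vimage_algebra[OF this] have "(\<lambda>\<omega> j. z j \<omega>) -` ?D \<inter> space M \<in> ?X" .
    moreover have "(\<lambda>\<omega> j. z j \<omega>) -` ?D \<inter> space M = C p"
      using measurable_space[OF zm] by (auto simp: C_def space_PiM)
    ultimately show ?thesis by simp
  qed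
  have SC: "S p \<in> events" "C p \<in> events" "prob (S p \<inter> C p) = prob (S p) * prob (C p)" if "p \<in> ?P" for p
    using indep_setD[OF indep S[OF that] C] indep_setD_ev1[OF indep] indep_setD_ev2[OF indep] S[OF that] C
    by auto
  have eq: "{\<omega> \<in> space M. close_cycles n (\<sigma> n \<omega>) \<delta> (\<lambda>j. z j \<omega>)} = (\<Union>p\<in>?P. S p \<inter> C p)"
    using \<sigma>P n unfolding S_def C_def by auto
  show "{\<omega> \<in> space M. close_cycles n (\<sigma> n \<omega>) \<delta> (\<lambda>j. z j \<omega>)} \<in> events"
    unfolding eq using SC fin by (intro sets.finite_UN) auto
  have "prob (\<Union>p\<in>?P. S p \<inter> C p) \<le> (\<Sum>p\<in>?P. prob (S p \<inter> C p))"
    using SC fin by (intro finite_measure_subadditive_finite) auto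
  also have "\<dots> = (\<Sum>p\<in>?P. prob (S p) * prob (C p))"
    using SC by (intro sum.cong) auto
  also have "\<dots> \<le> (\<Sum>p\<in>?P. prob (S p) * (real n ^ 2 * \<delta>))"
    unfolding C_def using prob_close_cycles_le[OF ind unif _ \<delta>] by (intro sum_mono mult_left_mono) auto
  also have "\<dots> = prob (\<Union>p\<in>?P. S p) * (real n ^ 2 * \<delta>)"
    unfolding sum_distrib_right[symmetric]
    using SC fin by (subst finite_measure_finite_Union) (auto simp: disjoint_family_on_def S_def)
  also have "\<dots> \<le> 1 * (real n ^ 2 * \<delta>)"
    using \<delta> by (intro mult_right_mono) auto
  finally show "prob {\<omega> \<in> space M. close_cycles n (\<sigma> n \<omega>) \<delta> (\<lambda>j. z j \<omega>)} \<le> real n ^ 2 * \<delta>"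
    unfolding eq by simp
qed

end

text \<open>Lists the eigenangles by countably many explicit functions of the phases, which serves
  measurability.\<close>

lemma eigenangles_eq_Arg:
  assumes p: "p permutes {..<n}" and z: "\<And>j. norm (z j) = 1"
  shows "t \<in> eigenangles (phase_perm_matrix n p z) \<longleftrightarrow>
    (\<exists>i<n. \<exists>k :: int. t = (Arg (\<Prod>j\<in>orbit p i. z j) + 2 * pi * k) / cycle_len p i)"
proof -
  have "cis (cycle_len p i * t) = (\<Prod>j\<in>orbit p i. z j) \<longleftrightarrow>
      (\<exists>k :: int. t = (Arg (\<Prod>j\<in>orbit p i. z j) + 2 * pi * k) / cycle_len p i)" if "i < n" for i
  proof -
    have "0 < cycle_len p i" by (rule cycle_len_pos[OF p])
    then show ?thesis
      by (subst prod_eq_cis_Arg[OF z]) (auto simp: cis_eq_cis_iff field_simps)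
  qed
  then show ?thesis unfolding eigenangles_phase_perm_matrix[OF p] by blast
qed

text \<open>The smallest spacing is the least positive difference of eigenangles, so being below c
  is a countable union of conditions on the listed angles.\<close>

lemma min_spacing_measurable:
  fixes z :: "'a \<Rightarrow> nat \<Rightarrow> complex"
  assumes p: "p permutes {..<n}" and n: "0 < n"
    and zm: "\<And>j. (\<lambda>\<omega>. z \<omega> j) \<in> M \<rightarrow>\<^sub>M circle_space"
  shows "(\<lambda>\<omega>. min_spacing (phase_perm_matrix n p (z \<omega>))) \<in> borel_measurable M"
  unfolding borel_measurable_iff_less
proof
  fix c :: real
  define x where "x \<omega> i k = (Arg (\<Prod>j\<in>orbit p i. z \<omega> j) + 2 * pi * real_of_int k) / cycle_len p i" for \<omega> i k
  have [measurable]: "(\<lambda>\<omega>. z \<omega> j) \<in> borel_measurable M" for j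
    using zm measurable_circle_iff by blast
  have norm: "norm (z \<omega> j) = 1" if "\<omega> \<in> space M" for \<omega> j
    using zm[of j] that unfolding measurable_circle_iff by blast
  \<comment> \<open>\<open>Arg\<close> is the imaginary part of \<open>Ln\<close> away from 0, and
    these products have modulus 1.\<close>
  have [measurable]: "(\<lambda>\<omega>. Arg (\<Prod>j\<in>orbit p i. z \<omega> j)) \<in> borel_measurable M" for i
  proof -
    have "(\<lambda>\<omega>. Im (Ln (\<Prod>j\<in>orbit p i. z \<omega> j))) \<in> borel_measurable M"
      by measurable
    moreover have "Arg (\<Prod>j\<in>orbit p i. z \<omega> j) = Im (Ln (\<Prod>j\<in>orbit p i. z \<omega> j))"
      if "\<omega> \<in> space M" for \<omega>
    proof (rule Arg_eq_Im_Ln)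
      have "norm (\<Prod>j\<in>orbit p i. z \<omega> j) = 1" using norm[OF that] by (simp add: prod_norm[symmetric])
      then show "(\<Prod>j\<in>orbit p i. z \<omega> j) \<noteq> 0" by auto
    qed
    ultimately show ?thesis by (subst measurable_cong) auto
  qed
  have [measurable]: "(\<lambda>\<omega>. x \<omega> i k) \<in> borel_measurable M" for i k
    unfolding x_def by measurable
  have "min_spacing (phase_perm_matrix n p (z \<omega>)) < c \<longleftrightarrow>
     (\<exists>i\<in>{..<n}. \<exists>j\<in>{..<n}. \<exists>k l. x \<omega> i k < x \<omega> j l \<and> x \<omega> j l - x \<omega> i k < c)" if "\<omega> \<in> space M" for \<omega>
  proof -
    note E = eigenangles_eq_Arg[where z = "z \<omega>", OF p norm[OF that], folded x_def]
    note ms = min_spacing_phase_perm_matrix[where z = "z \<omega>", OF p n norm[OF that]]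
    show ?thesis
    proof
      assume small: "min_spacing (phase_perm_matrix n p (z \<omega>)) < c"
      obtain s t where st: "s \<in> eigenangles (phase_perm_matrix n p (z \<omega>))"
        "t \<in> eigenangles (phase_perm_matrix n p (z \<omega>))" "s < t"
        "min_spacing (phase_perm_matrix n p (z \<omega>)) = t - s"
        using ms(1) by blast
      then obtain i k j l where "i < n" "j < n" "s = x \<omega> i k" "t = x \<omega> j l"
        unfolding E by blast
      with st small show "\<exists>i\<in>{..<n}. \<exists>j\<in>{..<n}. \<exists>k l. x \<omega> i k < x \<omega> j l \<and> x \<omega> j l - x \<omega> i k < c"
        by auto
    next
      assume "\<exists>i\<in>{..<n}. \<exists>j\<in>{..<n}. \<exists>k l. x \<omega> i k < x \<omega> j l \<and> x \<omega> j l - x \<omega> i k < c"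
      then obtain i j k l where *: "i < n" "j < n" "x \<omega> i k < x \<omega> j l" "x \<omega> j l - x \<omega> i k < c" by auto
      then have "min_spacing (phase_perm_matrix n p (z \<omega>)) \<le> x \<omega> j l - x \<omega> i k"
        using E by (intro ms(2)) blast+
      with * show "min_spacing (phase_perm_matrix n p (z \<omega>)) < c" by simp
    qed
  qed
  note iff = this
  have "{\<omega> \<in> space M. min_spacing (phase_perm_matrix n p (z \<omega>)) < c} =
     {\<omega> \<in> space M. \<exists>i\<in>{..<n}. \<exists>j\<in>{..<n}. \<exists>k l. x \<omega> i k < x \<omega> j l \<and> x \<omega> j l - x \<omega> i k < c}"
    by (intro Collect_cong conj_cong refl iff)
  also have "\<dots> \<in> sets M" by measurable
  finally show "{\<omega> \<in> space M. min_spacing (phase_perm_matrix n p (z \<omega>)) < c} \<in> sets M" .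
qed

section \<open>Tightness\<close>

text \<open>\<open>ewens_small_lcm\<close> divided by the normalising
  \<open>pochhammer \<theta> n\<close>, passed to the complementary event.\<close>

lemma (in prob_space) ewens_large_lcm:
  fixes \<sigma> :: "nat \<Rightarrow> 'a \<Rightarrow> nat \<Rightarrow> nat"
  assumes \<theta>: "0 < \<theta>" and \<epsilon>: "0 < \<epsilon>"
    and \<sigma>: "\<And>n. n \<ge> 1 \<Longrightarrow> \<sigma> n \<in> M \<rightarrow>\<^sub>M sym_space n"
    and law: "\<And>n p. n \<ge> 1 \<Longrightarrow> p permutes {..<n} \<Longrightarrow> prob {\<omega> \<in> space M. \<sigma> n \<omega> = p} = ewens \<theta> n p"
  obtains c :: real where "0 < c"
    and "\<And>n. 1 \<le> n \<Longrightarrow> 1 - \<epsilon> \<le> prob {\<omega> \<in> space M.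
      \<exists>i<n. \<exists>j<n. c * real n ^ 2 \<le> lcm (cycle_len (\<sigma> n \<omega>) i) (cycle_len (\<sigma> n \<omega>) j)}"
proof -
  obtain c :: real where c: "0 < c"
    "\<And>n :: nat. 1 \<le> n \<Longrightarrow> (\<Sum>p | p permutes {..<n}. \<theta> ^ card (orbit p ` {..<n}) *
            of_bool (\<forall>i<n. \<forall>j<n. real (lcm (cycle_len p i) (cycle_len p j)) < c * real n ^ 2))
     \<le> \<epsilon> * pochhammer \<theta> n"
    using ewens_small_lcm[OF \<theta> \<epsilon>] by blast
  show thesis
  proof (rule that[OF c(1)])
    fix n :: nat assume n: "1 \<le> n"
    let ?bad = "\<lambda>p. \<forall>i<n. \<forall>j<n. real (lcm (cycle_len p i) (cycle_len p j)) < c * real n ^ 2"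
    let ?P = "{p. p permutes {..<n}}"
    define S where "S p = {\<omega> \<in> space M. \<sigma> n \<omega> = p}" for p
    have fin: "finite ?P" by (simp add: finite_permutations)
    have \<sigma>P: "\<sigma> n \<omega> permutes {..<n}" if "\<omega> \<in> space M" for \<omega>
      using measurable_space[OF \<sigma>[OF n] that] by simp
    have S: "S p \<in> events" if "p \<in> ?P" for p
    proof -
      have "\<sigma> n -` {p} \<inter> space M \<in> events"
        using that by (intro measurable_sets[OF \<sigma>[OF n]]) auto
      then show ?thesis by (simp add: S_def vimage_def Int_def conj_commute)
    qed
    have eq: "{\<omega> \<in> space M. ?bad (\<sigma> n \<omega>)} = (\<Union>p\<in>{p \<in> ?P. ?bad p}. S p)"
      using \<sigma>P by (auto simp: S_def)
    have ev: "{\<omega> \<in> space M. ?bad (\<sigma> n \<omega>)} \<in> events"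
      unfolding eq using S fin by (intro sets.finite_UN) auto
    have "prob {\<omega> \<in> space M. ?bad (\<sigma> n \<omega>)} \<le> (\<Sum>p\<in>{p \<in> ?P. ?bad p}. prob (S p))"
      unfolding eq using S fin by (intro finite_measure_subadditive_finite) auto
    also have "\<dots> = (\<Sum>p\<in>{p \<in> ?P. ?bad p}. ewens \<theta> n p)"
      unfolding S_def using law[OF n] by (intro sum.cong) auto
    also have "\<dots> = (\<Sum>p\<in>?P. of_bool (?bad p) * ewens \<theta> n p)"
      using fin by (intro sum.mono_neutral_cong_left) auto
    also have "\<dots> = (\<Sum>p\<in>?P. \<theta> ^ card (orbit p ` {..<n}) * of_bool (?bad p)) / pochhammer \<theta> n"
      by (simp add: ewens_def num_cycles_def sum_divide_distrib mult_ac)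
    also have "\<dots> \<le> \<epsilon>"
      using c(2)[OF n] pochhammer_pos[OF \<theta>, of n] by (subst pos_divide_le_eq) auto
    finally have "1 - \<epsilon> \<le> 1 - prob {\<omega> \<in> space M. ?bad (\<sigma> n \<omega>)}" by simp
    also have "\<dots> = prob (space M - {\<omega> \<in> space M. ?bad (\<sigma> n \<omega>)})"
      by (rule prob_compl[OF ev, symmetric])
    also have "space M - {\<omega> \<in> space M. ?bad (\<sigma> n \<omega>)} =
      {\<omega> \<in> space M. \<exists>i<n. \<exists>j<n. c * real n ^ 2 \<le> lcm (cycle_len (\<sigma> n \<omega>) i) (cycle_len (\<sigma> n \<omega>) j)}"
    proof -
      have "\<not> ?bad p \<longleftrightarrow> (\<exists>i<n. \<exists>j<n. c * real n ^ 2 \<le> lcm (cycle_len p i) (cycle_len p j))" for p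
        by (simp add: not_less)
      then show ?thesis by blast
    qed
    finally show "1 - \<epsilon> \<le> prob {\<omega> \<in> space M.
      \<exists>i<n. \<exists>j<n. c * real n ^ 2 \<le> lcm (cycle_len (\<sigma> n \<omega>) i) (cycle_len (\<sigma> n \<omega>) j)}" .
  qed
qed

theorem proposition28:
  fixes M :: "'a measure"
    and \<theta> :: real
    and \<sigma> :: "nat \<Rightarrow> 'a \<Rightarrow> nat \<Rightarrow> nat"
    and z :: "nat \<Rightarrow> 'a \<Rightarrow> complex"
  assumes "prob_space M"
    and "\<theta> > 0"
    and "\<And>n. n \<ge> 1 \<Longrightarrow> \<sigma> n \<in> M \<rightarrow>\<^sub>M sym_space n"
    and "\<And>n \<pi>. n \<ge> 1 \<Longrightarrow> \<pi> permutes {..<n} \<Longrightarrow>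
           measure M {\<omega> \<in> space M. \<sigma> n \<omega> = \<pi>} = ewens \<theta> n \<pi>"
    and "prob_space.indep_vars M (\<lambda>_. circle_space) z UNIV"
    and "\<And>j. distr M circle_space (z j) = uniform_circle"
    and "prob_space.indep_set M
           (sets (vimage_algebra (space M) (\<lambda>\<omega>. \<lambda>n\<in>{1..}. \<sigma> n \<omega>) (Pi\<^sub>M {1..} sym_space)))
           (sets (vimage_algebra (space M) (\<lambda>\<omega> j. z j \<omega>) (Pi\<^sub>M UNIV (\<lambda>_. circle_space))))"
  shows "tight_rvs M (\<lambda>n \<omega>. real n ^ 2 * min_spacing (perm_matrix n (\<sigma> n \<omega>))) \<and>
         tight_rvs M (\<lambda>n \<omega>. real n ^ 2 *
           min_spacing (phase_perm_matrix n (\<sigma> n \<omega>) (\<lambda>j. z j \<omega>))) \<and>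
         tight_rvs M (\<lambda>n \<omega>. 1 / (real n ^ 2 * min_spacing (perm_matrix n (\<sigma> n \<omega>)))) \<and>
         tight_rvs M (\<lambda>n \<omega>. 1 / (real n ^ 2 *
           min_spacing (phase_perm_matrix n (\<sigma> n \<omega>) (\<lambda>j. z j \<omega>))))"
proof -
  interpret prob_space M by (rule assms(1))
  note \<sigma> = assms(3) and law = assms(4) and ind = assms(5) and unif = assms(6) and indep = assms(7)
  have \<sigma>P: "\<sigma> n \<omega> permutes {..<n}" if "\<omega> \<in> space M" "1 \<le> n" for n \<omega>
    using measurable_space[OF \<sigma>[OF that(2)] that(1)] by simp
  have zm: "z k \<in> M \<rightarrow>\<^sub>M circle_space" for k
    using ind unfolding indep_vars_def by auto
  have norm_z: "norm (z k \<omega>) = 1" if "\<omega> \<in> space M" for k \<omega>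
    using zm[of k] that unfolding measurable_circle_iff by blast
  have one: "norm (1 :: complex) = 1" by simp
  let ?d = "\<lambda>n \<omega>. min_spacing (perm_matrix n (\<sigma> n \<omega>))"
  let ?e = "\<lambda>n \<omega>. min_spacing (phase_perm_matrix n (\<sigma> n \<omega>) (\<lambda>j. z j \<omega>))"
  have dm: "random_variable borel (?d n)" if "1 \<le> n" for n
    using measurable_compose[OF \<sigma>[OF that], of "\<lambda>p. min_spacing (perm_matrix n p)" borel] by simp
  \<comment> \<open>The permutation takes finitely many values, so measurability is checked for each
    fixed permutation.\<close>
  have em: "random_variable borel (?e n)" if "1 \<le> n" for n
  proof (rule measurable_compose_countable'[OF _ \<sigma>[OF that]])
    show "countable {p. p permutes {..<n}}"
      by (intro countable_finite finite_permutations) simp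
    show "(\<lambda>\<omega>. min_spacing (phase_perm_matrix n p (\<lambda>j. z j \<omega>))) \<in> borel_measurable M"
      if "p \<in> {p. p permutes {..<n}}" for p
      using that \<open>1 \<le> n\<close> zm by (intro min_spacing_measurable) auto
  qed
  \<comment> \<open>Serves both matrix models, since the bound 2 pi / lcm holds whatever the phases
    are.\<close>
  have upper: "tight_rvs M (\<lambda>n \<omega>. real n ^ 2 * f n \<omega>)"
    if fm: "\<And>n. 1 \<le> n \<Longrightarrow> random_variable borel (f n)"
      and pos: "\<And>n \<omega>. 1 \<le> n \<Longrightarrow> \<omega> \<in> space M \<Longrightarrow> 0 < f n \<omega>"
      and le: "\<And>n \<omega> i j. 1 \<le> n \<Longrightarrow> \<omega> \<in> space M \<Longrightarrow> i < n \<Longrightarrow> j < n \<Longrightarrow>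
        f n \<omega> \<le> 2 * pi / lcm (cycle_len (\<sigma> n \<omega>) i) (cycle_len (\<sigma> n \<omega>) j)"
    for f :: "nat \<Rightarrow> 'a \<Rightarrow> real"
    unfolding tight_rvs_iff
  proof (intro conjI allI impI)
    show [measurable]: "random_variable borel (\<lambda>\<omega>. real n ^ 2 * f n \<omega>)" if "1 \<le> n" for n
      using fm[OF that] by measurable
    fix \<epsilon> :: real assume "0 < \<epsilon>"
    from ewens_large_lcm[OF assms(2) this \<sigma> law] obtain c :: real where c: "0 < c"
      "\<And>n. 1 \<le> n \<Longrightarrow> 1 - \<epsilon> \<le> prob {\<omega> \<in> space M.
        \<exists>i<n. \<exists>j<n. c * real n ^ 2 \<le> lcm (cycle_len (\<sigma> n \<omega>) i) (cycle_len (\<sigma> n \<omega>) j)}"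
      by blast
    have "1 - \<epsilon> \<le> prob {\<omega> \<in> space M. \<bar>real n ^ 2 * f n \<omega>\<bar> \<le> 2 * pi / c}" if n: "1 \<le> n" for n
    proof (rule order_trans[OF c(2)[OF n] finite_measure_mono])
      have [measurable]: "random_variable borel (f n)" using fm[OF n] .
      show "{\<omega> \<in> space M. \<bar>real n ^ 2 * f n \<omega>\<bar> \<le> 2 * pi / c} \<in> events" by measurable
      show "{\<omega> \<in> space M. \<exists>i<n. \<exists>j<n. c * real n ^ 2 \<le> lcm (cycle_len (\<sigma> n \<omega>) i) (cycle_len (\<sigma> n \<omega>) j)}
        \<subseteq> {\<omega> \<in> space M. \<bar>real n ^ 2 * f n \<omega>\<bar> \<le> 2 * pi / c}"
      proof safe
        fix \<omega> i j assume \<omega>: "\<omega> \<in> space M" "i < n" "j < n"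
          and l: "c * real n ^ 2 \<le> lcm (cycle_len (\<sigma> n \<omega>) i) (cycle_len (\<sigma> n \<omega>) j)" (is "_ \<le> real ?l")
        have cn: "0 < c * real n ^ 2" using c n by simp
        have "f n \<omega> \<le> 2 * pi / ?l" by (rule le[OF n \<omega>])
        also have "\<dots> \<le> 2 * pi / (c * real n ^ 2)"
          using l cn by (intro divide_left_mono) (auto intro!: mult_pos_pos)
        finally have "real n ^ 2 * f n \<omega> \<le> real n ^ 2 * (2 * pi / (c * real n ^ 2))"
          by (intro mult_left_mono) auto
        also have "\<dots> = 2 * pi / c" using n by simp
        finally show "\<bar>real n ^ 2 * f n \<omega>\<bar> \<le> 2 * pi / c"
          using pos[OF n \<omega>(1)] by simp
      qed
    qed
    then show "\<exists>\<eta>>0. \<forall>n\<ge>1. 1 - \<epsilon> \<le> prob {\<omega> \<in> space M. \<bar>real n ^ 2 * f n \<omega>\<bar> \<le> \<eta>}"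
      using c(1) by (intro exI[of _ "2 * pi / c"]) simp
  qed
  have "tight_rvs M (\<lambda>n \<omega>. real n ^ 2 * ?d n \<omega>)"
    using min_spacing_pos[OF \<sigma>P _ one] min_spacing_le_lcm[OF \<sigma>P _ one]
    by (intro upper dm) (auto simp: perm_matrix_eq_phase)
  moreover have "tight_rvs M (\<lambda>n \<omega>. real n ^ 2 * ?e n \<omega>)"
    using min_spacing_pos[OF \<sigma>P _ norm_z] min_spacing_le_lcm[OF \<sigma>P _ norm_z]
    by (intro upper em) auto
  moreover have "tight_rvs M (\<lambda>n \<omega>. 1 / (real n ^ 2 * ?d n \<omega>))"
    unfolding tight_rvs_iff
  proof (intro conjI allI impI)
    show "random_variable borel (\<lambda>\<omega>. 1 / (real n ^ 2 * ?d n \<omega>))" if "1 \<le> n" for n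
      using dm[OF that] by measurable
    fix \<epsilon> :: real assume \<epsilon>: "0 < \<epsilon>"
    \<comment> \<open>Without phases the lower bound is deterministic, so one constant serves all
      \<epsilon>.\<close>
    have "{\<omega> \<in> space M. \<bar>1 / (real n ^ 2 * ?d n \<omega>)\<bar> \<le> 1 / (2 * pi)} = space M" if n: "1 \<le> n" for n
    proof -
      have "\<bar>1 / (real n ^ 2 * ?d n \<omega>)\<bar> \<le> 1 / (2 * pi)" if \<omega>: "\<omega> \<in> space M" for \<omega>
      proof -
        have "2 * pi / real n ^ 2 \<le> ?d n \<omega>"
          using min_spacing_perm_matrix_ge[OF \<sigma>P[OF \<omega> n]] n by simp
        then have "2 * pi \<le> real n ^ 2 * ?d n \<omega>" using n by (simp add: field_simps)
        moreover from this have pos: "0 < real n ^ 2 * ?d n \<omega>"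
          using pi_gt_zero by linarith
        ultimately have "1 / (real n ^ 2 * ?d n \<omega>) \<le> 1 / (2 * pi)"
          by (intro divide_left_mono mult_pos_pos[OF pos]) auto
        with pos show ?thesis by (simp only: abs_of_pos zero_less_divide_1_iff)
      qed
      then show ?thesis by blast
    qed
    then show "\<exists>\<eta>>0. \<forall>n\<ge>1. 1 - \<epsilon> \<le> prob {\<omega> \<in> space M. \<bar>1 / (real n ^ 2 * ?d n \<omega>)\<bar> \<le> \<eta>}"
      using \<epsilon> by (intro exI[of _ "1 / (2 * pi)"]) (simp add: prob_space)
  qed
  moreover have "tight_rvs M (\<lambda>n \<omega>. 1 / (real n ^ 2 * ?e n \<omega>))"
    unfolding tight_rvs_iff
  proof (intro conjI allI impI)
    show "random_variable borel (\<lambda>\<omega>. 1 / (real n ^ 2 * ?e n \<omega>))" if "1 \<le> n" for n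
      using em[OF that] by measurable
    fix \<epsilon> :: real assume \<epsilon>: "0 < \<epsilon>"
    \<comment> \<open>With \<delta> = c / n^2 the close-cycle event has probability at most n^2
      \<delta> = c \<le> \<epsilon>, while c \<le> 2 pi ensures \<delta> \<le> 2 pi / n^2, as
      \<open>small_min_spacing_cycles\<close> requires.\<close>
    define c where "c = min \<epsilon> (2 * pi)"
    have c: "0 < c" "c \<le> \<epsilon>" "c \<le> 2 * pi" using \<epsilon> by (auto simp: c_def)
    have "1 - \<epsilon> \<le> prob {\<omega> \<in> space M. \<bar>1 / (real n ^ 2 * ?e n \<omega>)\<bar> \<le> 1 / c}" if n: "1 \<le> n" for n
    proof -
      have [measurable]: "random_variable borel (?e n)" using em[OF n] .
      define \<delta> where "\<delta> = c / real n ^ 2"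
      have \<delta>: "0 \<le> \<delta>" "\<delta> \<le> 2 * pi / real n ^ 2" "real n ^ 2 * \<delta> = c"
        using c n by (auto simp: \<delta>_def intro!: divide_right_mono)
      let ?C = "{\<omega> \<in> space M. close_cycles n (\<sigma> n \<omega>) \<delta> (\<lambda>j. z j \<omega>)}"
      note C = prob_close_cycles_random_perm_le[OF \<sigma> ind unif indep n \<delta>(1)]
      have "1 - \<epsilon> \<le> 1 - prob ?C" using C(1) \<delta>(3) c(2) by simp
      also have "\<dots> = prob (space M - ?C)" by (rule prob_compl[OF C(2), symmetric])
      also have "\<dots> \<le> prob {\<omega> \<in> space M. \<bar>1 / (real n ^ 2 * ?e n \<omega>)\<bar> \<le> 1 / c}"
      proof (rule finite_measure_mono)
        show "{\<omega> \<in> space M. \<bar>1 / (real n ^ 2 * ?e n \<omega>)\<bar> \<le> 1 / c} \<in> events" by measurable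
        show "space M - ?C \<subseteq> {\<omega> \<in> space M. \<bar>1 / (real n ^ 2 * ?e n \<omega>)\<bar> \<le> 1 / c}"
        proof safe
          fix \<omega> assume \<omega>: "\<omega> \<in> space M" and nc: "\<not> close_cycles n (\<sigma> n \<omega>) \<delta> (\<lambda>j. z j \<omega>)"
          have n0: "0 < n" using n by simp
          have "\<not> ?e n \<omega> < \<delta>"
          proof
            assume "?e n \<omega> < \<delta>"
            moreover have "\<delta> \<le> 2 * pi / real (n ^ 2)" using \<delta>(2) by simp
            ultimately obtain i j where ij: "i < n" "j < n" "orbit (\<sigma> n \<omega>) i \<noteq> orbit (\<sigma> n \<omega>) j"
              "(\<Prod>k\<in>orbit (\<sigma> n \<omega>) j. z k \<omega>) ^ cycle_len (\<sigma> n \<omega>) i *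
                cnj ((\<Prod>k\<in>orbit (\<sigma> n \<omega>) i. z k \<omega>) ^ cycle_len (\<sigma> n \<omega>) j)
              \<in> circle_arc (real (cycle_len (\<sigma> n \<omega>) i * cycle_len (\<sigma> n \<omega>) j) * \<delta>)"
              by (rule small_min_spacing_cycles[OF \<sigma>P[OF \<omega> n] n0 norm_z[OF \<omega>]])
            have "close_cycles n (\<sigma> n \<omega>) \<delta> (\<lambda>j. z j \<omega>)"
              unfolding close_cycles_def
              by (rule bexI[of _ "orbit (\<sigma> n \<omega>) i"], rule bexI[of _ "orbit (\<sigma> n \<omega>) j"]) (use ij in auto)
            with nc show False by contradiction
          qed
          then have "real n ^ 2 * \<delta> \<le> real n ^ 2 * ?e n \<omega>" by (intro mult_left_mono) auto
          then have ce: "c \<le> real n ^ 2 * ?e n \<omega>" using \<delta>(3) by simp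
          then have pos: "0 < real n ^ 2 * ?e n \<omega>"
            using c(1) by linarith
          have "1 / (real n ^ 2 * ?e n \<omega>) \<le> 1 / c"
            using ce c(1) by (intro divide_left_mono mult_pos_pos[OF pos]) auto
          with pos show "\<bar>1 / (real n ^ 2 * ?e n \<omega>)\<bar> \<le> 1 / c"
            by (simp only: abs_of_pos zero_less_divide_1_iff)
        qed
      qed
      finally show ?thesis .
    qed
    then show "\<exists>\<eta>>0. \<forall>n\<ge>1. 1 - \<epsilon> \<le> prob {\<omega> \<in> space M. \<bar>1 / (real n ^ 2 * ?e n \<omega>)\<bar> \<le> \<eta>}"
      using c(1) by (intro exI[of _ "1 / c"]) simp
  qed
  ultimately show ?thesis by blast
qed

end
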